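(* Let $(\mathcal N,P,h)$ be a 2-dimensional almost paracomplex Riemannian manifold with sectional (Gaussian) curvature $k'$ and associated metric $\widetilde h(x',y')=h(x',Py')$, and let $(\mathcal S(\mathcal N),\phi,\xi,\eta,g)$ be the 3-dimensional apapR manifold with $\mathcal S(\mathcal N)=\mathbb R^+\times\mathcal N$, $\phi(x',a\tfrac{d}{dt})=(Px',0)$, $\xi=\tfrac{d}{dt}$, $\eta=dt$ and $g=dt^2+\cosh 2t\,h+\sinh 2t\,\widetilde h$. Then the following properties are equivalent: (1) $(\mathcal N,P,h)$ is a $\mathcal W_0$-manifold; (2) $\rho=k'\cosh 2t\,g-(2+k'\cosh 2t)\,\eta\otimes\eta$; (3) $\rho^*=-(1+k'\cosh 2t)(\widetilde g-\eta\otimes\eta)$.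
   Context: An almost paracomplex Riemannian manifold $(\mathcal N,P,h)$ of dimension $2n$ is a differentiable manifold with an endomorphism $P$ of $T\mathcal N$ satisfying $P^2=I$, $P\neq I$, $\operatorname{tr}P=0$ and a Riemannian metric $h$ with $h(Px',Py')=h(x',y')$. Let $\nabla'$ be the Levi-Civita connection of $h$; $(\mathcal N,P,h)$ is called a $\mathcal W_0$-manifold if $\nabla'P=0$. When $\dim\mathcal N=2$, the curvature tensor of $h$ has the form $R'=k'\pi_1'$, where $\pi_1'(x',y')z'=h(y',z')x'-h(x',z')y'$ and $k'$ is the pointwise constant sectional curvature of $h$ (a function on $\mathcal N$, regarded also as a function on $\mathbb R^+\times\mathcal N$). An almost paracontact almost paracomplex Riemannian manifold (apapR manifold) $(\mathcal M,\phi,\xi,\eta,g)$ is a $(2n+1)$-dimensional differentiable manifold with an endomorphism $\phi$ of $T\mathcal M$, a vector field $\xi$, a 1-form $\eta$ and a Riemannian metric $g$ such that $\phi^2=\mathcal I-\eta\otimes\xi$, $\eta(\xi)=1$, $\eta\circ\phi=0$, $\phi\xi=0$, $\operatorname{tr}\phi=0$, $g(\phi x,\phi y)=g(x,y)-\eta(x)\eta(y)$. Its associated metric is $\widetilde g(x,y)=g(x,\phi y)+\eta(x)\eta(y)$. Curvature conventions for $g$ with Levi-Civita connection $\nabla$: $R(x,y)=[\nabla_x,\nabla_y]-\nabla_{[x,y]}$, $R(x,y,z,w)=g(R(x,y)z,w)$; $\rho(y,z)=g^{ij}R(e_i,y,z,e_j)$ and $\rho^*(y,z)=g^{ij}R(e_i,y,z,\phi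 e_j)$ for any basis $\{e_i\}$ of the tangent space. $\mathbb R^+$ is the set of positive reals, $t$ is its coordinate; tangent vectors of $\mathbb R^+\times\mathcal N$ are written $(x',a\tfrac{d}{dt})$ with $x'$ tangent to $\mathcal N$; $h$ and $\widetilde h$ are pulled back to the product. *)

theory Defs
  imports "HOL-Analysis.Analysis"
begin

section \<open>Smooth maps between Euclidean spaces\<close>

text \<open>\<open>Ck_on k S f\<close>: on the open set \<open>S\<close> all iterated directional derivatives of \<open>f\<close>
  of order at most \<open>k\<close> exist and are continuous, the derivatives being total ones.\<close>

primrec Ck_on :: "nat \<Rightarrow> 'e::euclidean_space set \<Rightarrow> ('e \<Rightarrow> 'f::real_normed_vector) \<Rightarrow> bool" where
  "Ck_on 0 S f = continuous_on S f"
| "Ck_on (Suc k) S f =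
     ((\<forall>x\<in>S. f differentiable (at x)) \<and>
      (\<forall>v. Ck_on k S (\<lambda>x. frechet_derivative f (at x) v)))"

definition smooth_on :: "'e::euclidean_space set \<Rightarrow> ('e \<Rightarrow> 'f::real_normed_vector) \<Rightarrow> bool" where
  "smooth_on S f \<longleftrightarrow> (\<forall>k. Ck_on k S f)"


section \<open>Smooth manifolds\<close>

text \<open>A manifold is a topological space with an atlas \<open>(U\<^sub>i, \<phi>\<^sub>i)\<close> indexed by \<open>i \<in> charts M\<close>; the
  charts take values in the Euclidean space \<open>'e\<close>, so that its dimension is \<open>DIM('e)\<close>.\<close>

record ('a, 'i, 'e) manifold =
  mtop :: "'a topology"
  charts :: "'i set"
  cdom :: "'i \<Rightarrow> 'a set"
  cmap :: "'i \<Rightarrow> 'a \<Rightarrow> 'e"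

definition cimg :: "('a, 'i, 'e) manifold \<Rightarrow> 'i \<Rightarrow> 'e set" where
  "cimg M i = cmap M i ` cdom M i"

definition overlap :: "('a, 'i, 'e) manifold \<Rightarrow> 'i \<Rightarrow> 'i \<Rightarrow> 'e set" where
  "overlap M i j = cmap M i ` (cdom M i \<inter> cdom M j)"

definition transition :: "('a, 'i, 'e) manifold \<Rightarrow> 'i \<Rightarrow> 'i \<Rightarrow> 'e \<Rightarrow> 'e" where
  "transition M i j = cmap M j \<circ> inv_into (cdom M i) (cmap M i)"

definition second_countable_space :: "'a topology \<Rightarrow> bool" where
  "second_countable_space X \<longleftrightarrow>
     (\<exists>B. countable B \<and> (\<forall>V\<in>B. openin X V) \<and>
          (\<forall>U x. openin X U \<and> x \<in> U \<longrightarrow> (\<exists>V\<in>B. x \<in> V \<and> V \<subseteq> U)))"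

definition smooth_manifold :: "('a, 'i, 'e::euclidean_space) manifold \<Rightarrow> bool" where
  "smooth_manifold M \<longleftrightarrow>
     Hausdorff_space (mtop M) \<and> second_countable_space (mtop M) \<and>
     (\<Union>i\<in>charts M. cdom M i) = topspace (mtop M) \<and>
     (\<forall>i\<in>charts M. openin (mtop M) (cdom M i) \<and> open (cimg M i) \<and>
        homeomorphic_map (subtopology (mtop M) (cdom M i)) (top_of_set (cimg M i)) (cmap M i)) \<and>
     (\<forall>i\<in>charts M. \<forall>j\<in>charts M. smooth_on (overlap M i j) (transition M i j))"


section \<open>Tensor fields\<close>

text \<open>A tangent vector at the point with coordinates \<open>x\<close> in the chart \<open>i\<close> is given by its
  components \<open>u :: 'e\<close> in that chart; in the chart \<open>j\<close> the same vector has the components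
  \<open>tangent_transition M i j x u\<close>.  A tensor field \<open>T\<close> is given by its components \<open>T i x\<close> in every
  chart \<open>i\<close> at every \<open>x \<in> cimg M i\<close>, subject to the corresponding transformation law.\<close>

definition tangent_transition :: "('a, 'i, 'e::euclidean_space) manifold \<Rightarrow> 'i \<Rightarrow> 'i \<Rightarrow> 'e \<Rightarrow> 'e \<Rightarrow> 'e" where
  "tangent_transition M i j x = frechet_derivative (transition M i j) (at x)"

definition vector_field :: "('a, 'i, 'e::euclidean_space) manifold \<Rightarrow> ('i \<Rightarrow> 'e \<Rightarrow> 'e) \<Rightarrow> bool" where
  "vector_field M X \<longleftrightarrow>
     (\<forall>i\<in>charts M. smooth_on (cimg M i) (X i)) \<and>
     (\<forall>i\<in>charts M. \<forall>j\<in>charts M. \<forall>x\<in>overlap M i j.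
        X j (transition M i j x) = tangent_transition M i j x (X i x))"

definition one_form :: "('a, 'i, 'e::euclidean_space) manifold \<Rightarrow> ('i \<Rightarrow> 'e \<Rightarrow> 'e \<Rightarrow> real) \<Rightarrow> bool" where
  "one_form M \<alpha> \<longleftrightarrow>
     (\<forall>i\<in>charts M. \<forall>x\<in>cimg M i. linear (\<alpha> i x)) \<and>
     (\<forall>i\<in>charts M. \<forall>u. smooth_on (cimg M i) (\<lambda>x. \<alpha> i x u)) \<and>
     (\<forall>i\<in>charts M. \<forall>j\<in>charts M. \<forall>x\<in>overlap M i j. \<forall>u.
        \<alpha> j (transition M i j x) (tangent_transition M i j x u) = \<alpha> i x u)"

definition endomorphism_field ::
  "('a, 'i, 'e::euclidean_space) manifold \<Rightarrow> ('i \<Rightarrow> 'e \<Rightarrow> 'e \<Rightarrow> 'e) \<Rightarrow> bool" where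
  "endomorphism_field M A \<longleftrightarrow>
     (\<forall>i\<in>charts M. \<forall>x\<in>cimg M i. linear (A i x)) \<and>
     (\<forall>i\<in>charts M. \<forall>u. smooth_on (cimg M i) (\<lambda>x. A i x u)) \<and>
     (\<forall>i\<in>charts M. \<forall>j\<in>charts M. \<forall>x\<in>overlap M i j. \<forall>u.
        A j (transition M i j x) (tangent_transition M i j x u)
          = tangent_transition M i j x (A i x u))"

definition riemannian_metric ::
  "('a, 'i, 'e::euclidean_space) manifold \<Rightarrow> ('i \<Rightarrow> 'e \<Rightarrow> 'e \<Rightarrow> 'e \<Rightarrow> real) \<Rightarrow> bool" where
  "riemannian_metric M g \<longleftrightarrow>
     (\<forall>i\<in>charts M. \<forall>x\<in>cimg M i. bilinear (g i x) \<and>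
        (\<forall>u v. g i x u v = g i x v u) \<and> (\<forall>u. u \<noteq> 0 \<longrightarrow> 0 < g i x u u)) \<and>
     (\<forall>i\<in>charts M. \<forall>u v. smooth_on (cimg M i) (\<lambda>x. g i x u v)) \<and>
     (\<forall>i\<in>charts M. \<forall>j\<in>charts M. \<forall>x\<in>overlap M i j. \<forall>u v.
        g j (transition M i j x) (tangent_transition M i j x u) (tangent_transition M i j x v)
          = g i x u v)"

definition trace_of :: "('e::euclidean_space \<Rightarrow> 'e) \<Rightarrow> real" where
  "trace_of A = (\<Sum>b\<in>Basis. A b \<bullet> b)"


section \<open>Levi-Civita connection and curvature\<close>

text \<open>In this section \<open>G\<close> is the component function \<open>g i\<close> of a metric in a fixed chart, and
  vector fields are maps from coordinates to components in that chart.\<close>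

text \<open>A connection is \<open>\<nabla>\<^sub>X Y = DY(X) + \<Gamma>(X, Y)\<close>.\<close>

definition covariant_derivative ::
  "('e::euclidean_space \<Rightarrow> 'e \<Rightarrow> 'e \<Rightarrow> 'e) \<Rightarrow> ('e \<Rightarrow> 'e) \<Rightarrow> ('e \<Rightarrow> 'e) \<Rightarrow> 'e \<Rightarrow> 'e" where
  "covariant_derivative \<Gamma> X Y x = frechet_derivative Y (at x) (X x) + \<Gamma> x (X x) (Y x)"

definition lie_bracket :: "('e::euclidean_space \<Rightarrow> 'e) \<Rightarrow> ('e \<Rightarrow> 'e) \<Rightarrow> 'e \<Rightarrow> 'e" where
  "lie_bracket X Y x = frechet_derivative Y (at x) (X x) - frechet_derivative X (at x) (Y x)"

text \<open>The Levi-Civita connection is the torsion-free metric connection.  Since the Lie bracket of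
  fields with constant components vanishes, torsion-freeness is the symmetry of \<open>\<Gamma>\<close>;
  \<open>w g(u,v) = g(\<nabla>\<^sub>w u, v) + g(u, \<nabla>\<^sub>w v)\<close> for constant \<open>u\<close>, \<open>v\<close>, \<open>w\<close> is metricity.\<close>

definition is_levi_civita_at ::
  "('e::euclidean_space \<Rightarrow> 'e \<Rightarrow> 'e \<Rightarrow> real) \<Rightarrow> 'e \<Rightarrow> ('e \<Rightarrow> 'e \<Rightarrow> 'e) \<Rightarrow> bool" where
  "is_levi_civita_at G x \<Gamma> \<longleftrightarrow>
     bilinear \<Gamma> \<and> (\<forall>u v. \<Gamma> u v = \<Gamma> v u) \<and>
     (\<forall>u v w. frechet_derivative (\<lambda>y. G y u v) (at x) w = G x (\<Gamma> w u) v + G x u (\<Gamma> w v))"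

definition levi_civita ::
  "('e::euclidean_space \<Rightarrow> 'e \<Rightarrow> 'e \<Rightarrow> real) \<Rightarrow> 'e \<Rightarrow> 'e \<Rightarrow> 'e \<Rightarrow> 'e" where
  "levi_civita G x = (THE \<Gamma>. is_levi_civita_at G x \<Gamma>)"

text \<open>\<open>(\<nabla>\<^sub>u A) v = \<nabla>\<^sub>u (A v) - A (\<nabla>\<^sub>u v)\<close>\<close>

definition covariant_derivative_endo ::
  "('e::euclidean_space \<Rightarrow> 'e \<Rightarrow> 'e \<Rightarrow> 'e) \<Rightarrow> ('e \<Rightarrow> 'e \<Rightarrow> 'e) \<Rightarrow> 'e \<Rightarrow> 'e \<Rightarrow> 'e \<Rightarrow> 'e" where
  "covariant_derivative_endo \<Gamma> A x u v =
     covariant_derivative \<Gamma> (\<lambda>_. u) (\<lambda>y. A y v) x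
     - A x (covariant_derivative \<Gamma> (\<lambda>_. u) (\<lambda>_. v) x)"

definition curvature_operator ::
  "('e::euclidean_space \<Rightarrow> 'e \<Rightarrow> 'e \<Rightarrow> 'e) \<Rightarrow> ('e \<Rightarrow> 'e) \<Rightarrow> ('e \<Rightarrow> 'e) \<Rightarrow> ('e \<Rightarrow> 'e) \<Rightarrow> 'e \<Rightarrow> 'e" where
  "curvature_operator \<Gamma> X Y Z x =
     covariant_derivative \<Gamma> X (covariant_derivative \<Gamma> Y Z) x
     - covariant_derivative \<Gamma> Y (covariant_derivative \<Gamma> X Z) x
     - covariant_derivative \<Gamma> (lie_bracket X Y) Z x"

text \<open>The curvature tensor on tangent vectors at \<open>x\<close>; they are extended to vector fields with
  constant components in the chart.\<close>

definition curvature ::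
  "('e::euclidean_space \<Rightarrow> 'e \<Rightarrow> 'e \<Rightarrow> real) \<Rightarrow> 'e \<Rightarrow> 'e \<Rightarrow> 'e \<Rightarrow> 'e \<Rightarrow> 'e" where
  "curvature G x u v w = curvature_operator (levi_civita G) (\<lambda>_. u) (\<lambda>_. v) (\<lambda>_. w) x"

definition curvature4 ::
  "('e::euclidean_space \<Rightarrow> 'e \<Rightarrow> 'e \<Rightarrow> real) \<Rightarrow> 'e \<Rightarrow> 'e \<Rightarrow> 'e \<Rightarrow> 'e \<Rightarrow> 'e \<Rightarrow> real" where
  "curvature4 G x u v w z = G x (curvature G x u v w) z"

text \<open>\<open>inverse_metric G x i j\<close> is \<open>g\<^sup>i\<^sup>j\<close>, the inverse of the matrix \<open>g\<^sub>j\<^sub>k = G x j k\<close> with \<open>j\<close>, \<open>k\<close>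
  ranging over the coordinate basis; the vector \<open>a\<close> is its row with index \<open>i\<close>.\<close>

definition inverse_metric ::
  "('e::euclidean_space \<Rightarrow> 'e \<Rightarrow> 'e \<Rightarrow> real) \<Rightarrow> 'e \<Rightarrow> 'e \<Rightarrow> 'e \<Rightarrow> real" where
  "inverse_metric G x i j =
     (THE a. \<forall>k\<in>Basis. (\<Sum>j\<in>Basis. (a \<bullet> j) * G x j k) = (if i = k then 1 else 0)) \<bullet> j"

definition ricci :: "('e::euclidean_space \<Rightarrow> 'e \<Rightarrow> 'e \<Rightarrow> real) \<Rightarrow> 'e \<Rightarrow> 'e \<Rightarrow> 'e \<Rightarrow> real" where
  "ricci G x y z = (\<Sum>i\<in>Basis. \<Sum>j\<in>Basis. inverse_metric G x i j * curvature4 G x i y z j)"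

definition ricci_star ::
  "('e::euclidean_space \<Rightarrow> 'e \<Rightarrow> 'e \<Rightarrow> real) \<Rightarrow> ('e \<Rightarrow> 'e \<Rightarrow> 'e) \<Rightarrow> 'e \<Rightarrow> 'e \<Rightarrow> 'e \<Rightarrow> real" where
  "ricci_star G \<phi> x y z =
     (\<Sum>i\<in>Basis. \<Sum>j\<in>Basis. inverse_metric G x i j * curvature4 G x i y z (\<phi> x j))"

definition sectional_curvature ::
  "('e::euclidean_space \<Rightarrow> 'e \<Rightarrow> 'e \<Rightarrow> real) \<Rightarrow> 'e \<Rightarrow> 'e \<Rightarrow> 'e \<Rightarrow> real" where
  "sectional_curvature G x u v =
     curvature4 G x u v v u / (G x u u * G x v v - (G x u v)\<^sup>2)"

text \<open>All tangent planes at a point \<open>p\<close> have the same sectional curvature \<open>k p\<close>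
  (in dimension 2 there is only one such plane).\<close>

definition pointwise_sectional_curvature ::
  "('a, 'i, 'e::euclidean_space) manifold \<Rightarrow> ('i \<Rightarrow> 'e \<Rightarrow> 'e \<Rightarrow> 'e \<Rightarrow> real) \<Rightarrow> ('a \<Rightarrow> real) \<Rightarrow> bool" where
  "pointwise_sectional_curvature M g k \<longleftrightarrow>
     (\<forall>i\<in>charts M. \<forall>p\<in>cdom M i. \<forall>u v. u \<noteq> v \<and> independent {u, v} \<longrightarrow>
        sectional_curvature (g i) (cmap M i p) u v = k p)"


section \<open>Almost paracomplex and almost paracontact almost paracomplex Riemannian manifolds\<close>

definition almost_paracomplex_riemannian ::
  "('a, 'i, 'e::euclidean_space) manifold \<Rightarrow> ('i \<Rightarrow> 'e \<Rightarrow> 'e \<Rightarrow> 'e) \<Rightarrow>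
   ('i \<Rightarrow> 'e \<Rightarrow> 'e \<Rightarrow> 'e \<Rightarrow> real) \<Rightarrow> bool" where
  "almost_paracomplex_riemannian M P h \<longleftrightarrow>
     smooth_manifold M \<and> (\<exists>n\<ge>1. DIM('e) = 2 * n) \<and>
     endomorphism_field M P \<and> riemannian_metric M h \<and>
     (\<forall>i\<in>charts M. \<forall>x\<in>cimg M i.
        (\<forall>u. P i x (P i x u) = u) \<and> P i x \<noteq> id \<and> trace_of (P i x) = 0 \<and>
        (\<forall>u v. h i x (P i x u) (P i x v) = h i x u v))"

definition W0_manifold ::
  "('a, 'i, 'e::euclidean_space) manifold \<Rightarrow> ('i \<Rightarrow> 'e \<Rightarrow> 'e \<Rightarrow> 'e) \<Rightarrow>
   ('i \<Rightarrow> 'e \<Rightarrow> 'e \<Rightarrow> 'e \<Rightarrow> real) \<Rightarrow> bool" where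
  "W0_manifold M P h \<longleftrightarrow>
     almost_paracomplex_riemannian M P h \<and>
     (\<forall>i\<in>charts M. \<forall>x\<in>cimg M i. \<forall>u v.
        covariant_derivative_endo (levi_civita (h i)) (P i) x u v = 0)"

definition apapR_manifold ::
  "('a, 'i, 'e::euclidean_space) manifold \<Rightarrow> ('i \<Rightarrow> 'e \<Rightarrow> 'e \<Rightarrow> 'e) \<Rightarrow> ('i \<Rightarrow> 'e \<Rightarrow> 'e) \<Rightarrow>
   ('i \<Rightarrow> 'e \<Rightarrow> 'e \<Rightarrow> real) \<Rightarrow> ('i \<Rightarrow> 'e \<Rightarrow> 'e \<Rightarrow> 'e \<Rightarrow> real) \<Rightarrow> bool" where
  "apapR_manifold M \<phi> \<xi> \<eta> g \<longleftrightarrow>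
     smooth_manifold M \<and> (\<exists>n\<ge>1. DIM('e) = 2 * n + 1) \<and>
     endomorphism_field M \<phi> \<and> vector_field M \<xi> \<and> one_form M \<eta> \<and> riemannian_metric M g \<and>
     (\<forall>i\<in>charts M. \<forall>x\<in>cimg M i.
        (\<forall>u. \<phi> i x (\<phi> i x u) = u - \<eta> i x u *\<^sub>R \<xi> i x) \<and>
        \<eta> i x (\<xi> i x) = 1 \<and> (\<forall>u. \<eta> i x (\<phi> i x u) = 0) \<and> \<phi> i x (\<xi> i x) = 0 \<and>
        trace_of (\<phi> i x) = 0 \<and>
        (\<forall>u v. g i x (\<phi> i x u) (\<phi> i x v) = g i x u v - \<eta> i x u * \<eta> i x v))"

definition paracomplex_assoc ::
  "('i \<Rightarrow> 'e \<Rightarrow> 'e \<Rightarrow> 'e) \<Rightarrow> ('i \<Rightarrow> 'e \<Rightarrow> 'e \<Rightarrow> 'e \<Rightarrow> real) \<Rightarrow> 'i \<Rightarrow> 'e \<Rightarrow> 'e \<Rightarrow> 'e \<Rightarrow> real" where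
  "paracomplex_assoc P h i x u v = h i x u (P i x v)"

definition apapR_assoc ::
  "('i \<Rightarrow> 'e \<Rightarrow> 'e \<Rightarrow> 'e) \<Rightarrow> ('i \<Rightarrow> 'e \<Rightarrow> 'e \<Rightarrow> real) \<Rightarrow> ('i \<Rightarrow> 'e \<Rightarrow> 'e \<Rightarrow> 'e \<Rightarrow> real) \<Rightarrow>
   'i \<Rightarrow> 'e \<Rightarrow> 'e \<Rightarrow> 'e \<Rightarrow> real" where
  "apapR_assoc \<phi> \<eta> g i x u v = g i x u (\<phi> i x v) + \<eta> i x u * \<eta> i x v"


section \<open>The manifold \<open>S(N)\<close>\<close>

text \<open>The charts of \<open>S(N) = \<real>\<^sup>+ \<times> N\<close> are \<open>(t, p) \<mapsto> (t, \<phi>\<^sub>i p)\<close> on \<open>\<real>\<^sup>+ \<times> U\<^sub>i\<close>, with the index set of the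
  atlas of \<open>N\<close>.  The tangent vector \<open>(x', a d/dt)\<close> has the components \<open>(a, u)\<close>, where \<open>u\<close> are
  the components of \<open>x'\<close>.\<close>

definition S_manifold :: "('a, 'i, 'e) manifold \<Rightarrow> (real \<times> 'a, 'i, real \<times> 'e) manifold" where
  "S_manifold N =
     \<lparr> mtop = prod_topology (top_of_set {0<..}) (mtop N),
       charts = charts N,
       cdom = (\<lambda>i. {0<..} \<times> cdom N i),
       cmap = (\<lambda>i (t, p). (t, cmap N i p)) \<rparr>"

definition S_phi ::
  "('i \<Rightarrow> 'e::euclidean_space \<Rightarrow> 'e \<Rightarrow> 'e) \<Rightarrow> 'i \<Rightarrow> real \<times> 'e \<Rightarrow> real \<times> 'e \<Rightarrow> real \<times> 'e" where
  "S_phi P i = (\<lambda>(t, x) (a, u). (0, P i x u))"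

definition S_xi :: "'i \<Rightarrow> real \<times> 'e::euclidean_space \<Rightarrow> real \<times> 'e" where
  "S_xi i = (\<lambda>(t, x). (1, 0))"

definition S_eta :: "'i \<Rightarrow> real \<times> 'e::euclidean_space \<Rightarrow> real \<times> 'e \<Rightarrow> real" where
  "S_eta i = (\<lambda>(t, x) (a, u). a)"

definition S_metric ::
  "('i \<Rightarrow> 'e::euclidean_space \<Rightarrow> 'e \<Rightarrow> 'e) \<Rightarrow> ('i \<Rightarrow> 'e \<Rightarrow> 'e \<Rightarrow> 'e \<Rightarrow> real) \<Rightarrow>
   'i \<Rightarrow> real \<times> 'e \<Rightarrow> real \<times> 'e \<Rightarrow> real \<times> 'e \<Rightarrow> real" where
  "S_metric P h i =
     (\<lambda>(t, x) (a, u) (b, v).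
        a * b + cosh (2 * t) * h i x u v + sinh (2 * t) * paracomplex_assoc P h i x u v)"


section \<open>Well-definedness\<close>

text \<open>The Levi-Civita connection exists and is unique, and \<open>S(N)\<close> with the structure above
  is an apapR manifold.\<close>

lemma riesz_pos_def:
  fixes B :: "'e::euclidean_space \<Rightarrow> 'e \<Rightarrow> real"
  assumes B: "bilinear B" and pos: "\<And>u. u \<noteq> 0 \<Longrightarrow> 0 < B u u" and f: "linear f"
  shows "\<exists>!w. \<forall>z. B w z = f z"
proof -
  define T where "T w = (\<Sum>b\<in>Basis. B w b *\<^sub>R b)" for w
  have linl: "linear (\<lambda>w. B w z)" and linr: "linear (B w)" for w z
    using B by (auto simp: bilinear_def)
  have linT: "linear T"
    unfolding T_def
    by (intro linear_compose_sum ballI linear_compose_scale_right)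
       (auto intro: linear_compose[OF linl, unfolded o_def] linl bounded_linear.linear
         simp: linear_iff linear_add[OF linl] linear_scale[OF linl] scaleR_left_distrib)
  have Tb: "T w \<bullet> b = B w b" if "b \<in> Basis" for w b
    using that by (simp add: T_def)
  have eq: "B w z = f z" if "\<And>b. b \<in> Basis \<Longrightarrow> B w b = f b" for w z
    using linear_eq_on_span[OF linr f, of Basis w] that span_Basis by (metis UNIV_I)
  have "inj T"
  proof (rule linear_injective_0[THEN iffD2, OF linT, rule_format])
    fix w assume "T w = 0"
    then have "\<And>b. b \<in> Basis \<Longrightarrow> B w b = 0" using Tb by (metis inner_zero_left)
    then have "B w w = 0"
      using linear_eq_on_span[OF linr module_hom_zero, of Basis w w] span_Basis by auto
    then show "w = 0" using pos by force
  qed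
  then have "surj T" using linT by (simp add: linear_injective_imp_surjective)
  then obtain w where w: "T w = (\<Sum>b\<in>Basis. f b *\<^sub>R b)" by (metis surjD)
  have "\<And>b. b \<in> Basis \<Longrightarrow> B w b = f b" by (metis Tb inner_sum_left_Basis w)
  then have ex: "\<forall>z. B w z = f z" using eq by blast
  moreover have "w' = w" if "\<forall>z. B w' z = f z" for w'
  proof -
    have "T w' = T w" unfolding T_def using that ex by simp
    then show ?thesis using \<open>inj T\<close> by (simp add: inj_eq)
  qed
  ultimately show ?thesis by blast
qed

lemma levi_civita_unique_ex:
  fixes G :: "'e::euclidean_space \<Rightarrow> 'e \<Rightarrow> 'e \<Rightarrow> real"
  assumes S: "open S" "x \<in> S"
    and bil: "\<And>y. y \<in> S \<Longrightarrow> bilinear (G y)" and sym: "\<And>y u v. y \<in> S \<Longrightarrow> G y u v = G y v u"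
    and pos: "\<And>u. u \<noteq> 0 \<Longrightarrow> 0 < G x u u"
    and diff: "\<And>u v. (\<lambda>y. G y u v) differentiable (at x)"
  shows "\<exists>!\<Gamma>. is_levi_civita_at G x \<Gamma>"
proof -
  define D where "D w u v = frechet_derivative (\<lambda>y. G y u v) (at x) w" for w u v
  have der: "((\<lambda>y. G y u v) has_derivative (\<lambda>w. D w u v)) (at x)" for u v
    unfolding D_def using diff frechet_derivative_works by blast
  have Dw: "linear (\<lambda>w. D w u v)" for u v
    using der has_derivative_linear by blast
  have Deq: "D w u v = d w" if "(f has_derivative d) (at x)" "\<And>y. y \<in> S \<Longrightarrow> f y = G y u v" for f d w u v
    using has_derivative_unique[OF der has_derivative_transform_within_open[OF that(1) S that(2)]]
    by metis
  have Dsym: "D w u v = D w v u" for w u v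
    by (rule Deq[OF der]) (simp add: sym)
  have Du: "linear (\<lambda>u. D w u v)" for w v
  proof (rule linearI)
    show "D w (a + b) v = D w a v + D w b v" for a b
      by (rule Deq[OF has_derivative_add[OF der der]]) (simp add: bilinear_ladd bil)
    show "D w (r *\<^sub>R a) v = r *\<^sub>R D w a v" for r a
      by (rule Deq[OF has_derivative_scaleR_right[OF der]]) (simp add: bilinear_lmul bil)
  qed
  have Dv: "linear (\<lambda>v. D w u v)" for w u
    using Du[of w u] Dsym[of w u] by presburger
  define K where "K u v z = (D u v z + D v u z - D z u v) / 2" for u v z
  note lin = linear_add[OF Dw] linear_add[OF Du] linear_add[OF Dv]
    linear_scale[OF Dw] linear_scale[OF Du] linear_scale[OF Dv]
  have Kz: "linear (K u v)" for u v
    by (rule linearI) (simp_all add: K_def lin algebra_simps add_divide_distrib diff_divide_distrib)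
  have bx: "bilinear (G x)" and sx: "G x u v = G x v u" for u v
    using bil sym S by auto
  have R: "\<exists>!w. \<forall>z. G x w z = K u v z" for u v
    by (rule riesz_pos_def[OF bx pos Kz])
  define \<Gamma> where "\<Gamma> u v = (THE w. \<forall>z. G x w z = K u v z)" for u v
  have G\<Gamma>: "G x (\<Gamma> u v) z = K u v z" for u v z
    using theI'[OF R[of u v]] unfolding \<Gamma>_def by blast
  have nondeg: "a = b" if "\<And>z. G x a z = G x b z" for a b
  proof -
    have "linear (G x b)" using bx by (simp add: bilinear_def)
    from riesz_pos_def[OF bx pos this] that show ?thesis by blast
  qed
  have "is_levi_civita_at G x \<Gamma>"
    unfolding is_levi_civita_at_def
  proof (intro conjI allI)
    show "\<Gamma> u v = \<Gamma> v u" for u v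
      by (rule nondeg) (simp add: G\<Gamma> K_def Dsym[of _ u v] add.commute)
    have l: "linear (\<lambda>u. \<Gamma> u v)" for v
      by (rule linearI; rule nondeg)
         (simp_all add: G\<Gamma> bilinear_ladd[OF bx] bilinear_lmul[OF bx] K_def lin algebra_simps
           add_divide_distrib diff_divide_distrib)
    moreover have "linear (\<lambda>v. \<Gamma> u v)" for u
      by (rule linearI; rule nondeg)
         (simp_all add: G\<Gamma> bilinear_ladd[OF bx] bilinear_lmul[OF bx] K_def lin algebra_simps
           add_divide_distrib diff_divide_distrib)
    ultimately show "bilinear \<Gamma>" by (simp add: bilinear_def)
    fix u v w
    have "G x (\<Gamma> w u) v + G x u (\<Gamma> w v) = K w u v + K w v u"
      by (simp add: G\<Gamma> sx[of u])
    also have "\<dots> = D w u v"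
      by (simp add: K_def Dsym[of w v u] Dsym[of u v w] Dsym[of v u w] field_simps)
    finally show "frechet_derivative (\<lambda>y. G y u v) (at x) w = G x (\<Gamma> w u) v + G x u (\<Gamma> w v)"
      by (simp add: D_def)
  qed
  moreover have "\<Gamma>' = \<Gamma>" if "is_levi_civita_at G x \<Gamma>'" for \<Gamma>'
  proof (intro ext nondeg)
    fix u v z
    have s: "\<Gamma>' u v = \<Gamma>' v u" for u v using that by (auto simp: is_levi_civita_at_def)
    have m: "D w u v = G x (\<Gamma>' w u) v + G x u (\<Gamma>' w v)" for u v w
      using that by (auto simp: is_levi_civita_at_def D_def)
    have "K u v z = G x (\<Gamma>' u v) z"
      unfolding K_def m by (simp add: s[of v u] s[of z u] s[of z v] sx[of _ "\<Gamma>' _ _"])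
    then show "G x (\<Gamma>' u v) z = G x (\<Gamma> u v) z" by (simp add: G\<Gamma>)
  qed
  ultimately show ?thesis by blast
qed

lemma Ck_on_cong:
  assumes "open S" "Ck_on k S f" "\<And>x. x \<in> S \<Longrightarrow> f x = g x"
  shows "Ck_on k S g"
  using assms
proof (induction k arbitrary: f g)
  case 0
  then show ?case by (auto cong: continuous_on_cong)
next
  case (Suc k)
  have d: "(g has_derivative frechet_derivative f (at x)) (at x)" if "x \<in> S" for x
    using Suc.prems that
    by (auto simp: frechet_derivative_works intro: has_derivative_transform_within_open)
  have e: "frechet_derivative f (at x) v = frechet_derivative g (at x) v" if "x \<in> S" for x v
    using frechet_derivative_at[OF d[OF that]] by simp
  show ?case
    using d Suc.prems Suc.IH[OF Suc.prems(1) _ e] by (auto simp: differentiable_def)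
qed

lemma Ck_on_SucI:
  assumes "open S" and d: "\<And>x. x \<in> S \<Longrightarrow> (f has_derivative D x) (at x)"
    and "\<And>v. Ck_on k S (\<lambda>x. D x v)"
  shows "Ck_on (Suc k) S f"
proof -
  have "Ck_on k S (\<lambda>x. frechet_derivative f (at x) v)" for v
    by (rule Ck_on_cong[OF assms(1) assms(3)[of v]]) (simp add: frechet_derivative_at[OF d, symmetric])
  then show ?thesis using d by (auto simp: differentiable_def)
qed

lemma Ck_on_Suc_imp: "Ck_on (Suc k) S f \<Longrightarrow> Ck_on k S f"
  by (induction k arbitrary: f)
     (auto intro!: differentiable_imp_continuous_on simp: differentiable_on_def differentiable_at_withinI)

lemma Ck_on_has_derivative:
  "Ck_on (Suc k) S f \<Longrightarrow> x \<in> S \<Longrightarrow> (f has_derivative frechet_derivative f (at x)) (at x)"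
  by (simp add: frechet_derivative_works)

lemma Ck_on_const: "open S \<Longrightarrow> Ck_on k S (\<lambda>x. c)"
proof (induction k arbitrary: c)
  case (Suc k)
  then show ?case by (intro Ck_on_SucI[where D = "\<lambda>_ _. 0"]) auto
qed simp

lemma Ck_on_linear:
  assumes "open S" "bounded_linear f" shows "Ck_on k S f"
proof (cases k)
  case (Suc k')
  show ?thesis unfolding Suc
    by (rule Ck_on_SucI[OF assms(1), where D = "\<lambda>_. f"])
       (use assms in \<open>auto intro: bounded_linear_imp_has_derivative Ck_on_const\<close>)
qed (use assms in \<open>simp add: linear_continuous_on\<close>)

lemma Ck_on_bilinear:
  assumes S: "open S" and b: "bounded_bilinear p"
  shows "Ck_on k S f \<Longrightarrow> Ck_on k S g \<Longrightarrow> Ck_on k S (\<lambda>x. p (f x) (g x))"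
    and "Ck_on k S f' \<Longrightarrow> Ck_on k S g' \<Longrightarrow> Ck_on k S (\<lambda>x. f' x + g' x)"
proof -
  have add: "Ck_on k S f \<Longrightarrow> Ck_on k S g \<Longrightarrow> Ck_on k S (\<lambda>x. f x + g x)" for k and f g :: "'a \<Rightarrow> 'f::real_normed_vector"
  proof (induction k arbitrary: f g)
    case (Suc k)
    show ?case
      by (rule Ck_on_SucI[OF S has_derivative_add[OF Ck_on_has_derivative Ck_on_has_derivative]])
         (use Suc in auto)
  qed (simp add: continuous_on_add)
  then show "Ck_on k S f' \<Longrightarrow> Ck_on k S g' \<Longrightarrow> Ck_on k S (\<lambda>x. f' x + g' x)" .
  show "Ck_on k S f \<Longrightarrow> Ck_on k S g \<Longrightarrow> Ck_on k S (\<lambda>x. p (f x) (g x))"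
  proof (induction k arbitrary: f g)
    case 0 then show ?case using bounded_bilinear.continuous_on[OF b] by simp
  next
    case (Suc k)
    show ?case
    proof (rule Ck_on_SucI[OF S bounded_bilinear.FDERIV[OF b Ck_on_has_derivative Ck_on_has_derivative]])
      show "Ck_on k S (\<lambda>x. p (f x) (frechet_derivative g (at x) v) + p (frechet_derivative f (at x) v) (g x))" for v
        using Suc.prems by (intro add Suc.IH) (auto intro: Ck_on_Suc_imp)
    qed (use Suc.prems in auto)
  qed
qed

lemma smooth_on_cong: "open S \<Longrightarrow> smooth_on S f \<Longrightarrow> (\<And>x. x \<in> S \<Longrightarrow> f x = g x) \<Longrightarrow> smooth_on S g"
  unfolding smooth_on_def using Ck_on_cong by blast
lemma smooth_on_has_derivative:
  "smooth_on S f \<Longrightarrow> x \<in> S \<Longrightarrow> (f has_derivative frechet_derivative f (at x)) (at x)"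
  by (rule Ck_on_has_derivative[of 0]) (auto simp only: smooth_on_def)
lemma smooth_on_const: "open S \<Longrightarrow> smooth_on S (\<lambda>x. c)"
  by (simp add: smooth_on_def Ck_on_const)
lemma smooth_on_linear: "open S \<Longrightarrow> bounded_linear f \<Longrightarrow> smooth_on S f"
  by (simp add: smooth_on_def Ck_on_linear)
lemma smooth_on_add: "open S \<Longrightarrow> smooth_on S f \<Longrightarrow> smooth_on S g \<Longrightarrow> smooth_on S (\<lambda>x. f x + g x)"
  unfolding smooth_on_def using Ck_on_bilinear(2)[OF _ bounded_bilinear_mult] by blast
lemma smooth_on_mult: "open S \<Longrightarrow> smooth_on S f \<Longrightarrow> smooth_on S g \<Longrightarrow> smooth_on S (\<lambda>x. f x * g x :: real)"
  unfolding smooth_on_def using Ck_on_bilinear(1)[OF _ bounded_bilinear_mult] by blast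
lemma smooth_on_scaleR: "open S \<Longrightarrow> smooth_on S f \<Longrightarrow> smooth_on S g \<Longrightarrow> smooth_on S (\<lambda>x. f x *\<^sub>R g x)"
  unfolding smooth_on_def using Ck_on_bilinear(1)[OF _ bounded_bilinear_scaleR] by blast
lemma smooth_on_inner: "open S \<Longrightarrow> smooth_on S f \<Longrightarrow> smooth_on S g \<Longrightarrow> smooth_on S (\<lambda>x. f x \<bullet> g x)"
  unfolding smooth_on_def using Ck_on_bilinear(1)[OF _ bounded_bilinear_inner] by blast
lemma smooth_on_sum:
  assumes S: "open S"
  shows "finite A \<Longrightarrow> (\<And>a. a \<in> A \<Longrightarrow> smooth_on S (f a)) \<Longrightarrow> smooth_on S (\<lambda>x. \<Sum>a\<in>A. f a x)"
proof (induction A rule: finite_induct)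
  case empty
  then show ?case using S by (simp add: smooth_on_const)
next
  case (insert a A)
  then show ?case using S by (simp add: smooth_on_add)
qed

lemma Ck_on_compose_linear:
  fixes L :: "'d::euclidean_space \<Rightarrow> 'e::euclidean_space"
  assumes T: "open T" and L: "bounded_linear L" and LT: "L ` T \<subseteq> S"
  shows "Ck_on k S f \<Longrightarrow> Ck_on k T (\<lambda>x. f (L x))"
proof (induction k arbitrary: f)
  case 0
  then show ?case
    using continuous_on_compose2[OF _ linear_continuous_on[OF L] LT] by simp
next
  case (Suc k)
  show ?case
  proof (rule Ck_on_SucI[OF T])
    show "((\<lambda>x. f (L x)) has_derivative (\<lambda>v. frechet_derivative f (at (L x)) (L v))) (at x)" if "x \<in> T" for x
      using Suc.prems that LT
      by (intro has_derivative_compose[OF bounded_linear_imp_has_derivative[OF L]]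
            Ck_on_has_derivative) auto
    show "Ck_on k T (\<lambda>x. frechet_derivative f (at (L x)) (L v))" for v
      using Suc.prems by (intro Suc.IH) simp
  qed
qed

lemma smooth_on_compose_linear:
  "open T \<Longrightarrow> bounded_linear L \<Longrightarrow> L ` T \<subseteq> S \<Longrightarrow> smooth_on S f \<Longrightarrow> smooth_on T (\<lambda>x. f (L x))"
  unfolding smooth_on_def using Ck_on_compose_linear by blast

lemma Ck_on_bounded_linear:
  fixes f :: "'d::euclidean_space \<Rightarrow> 'e::real_normed_vector"
  assumes T: "open T" and L: "bounded_linear L"
  shows "Ck_on k T f \<Longrightarrow> Ck_on k T (\<lambda>x. L (f x))"
proof (induction k arbitrary: f)
  case 0
  then show ?case using bounded_linear.continuous_on[OF L] by simp
next
  case (Suc k)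
  show ?case
    by (rule Ck_on_SucI[OF T bounded_linear.has_derivative[OF L Ck_on_has_derivative]])
       (use Suc in auto)
qed

lemma smooth_on_Pair:
  fixes f :: "'d::euclidean_space \<Rightarrow> 'e::real_normed_vector" and g :: "'d \<Rightarrow> 'f::real_normed_vector"
  assumes T: "open T" and "smooth_on T f" "smooth_on T g"
  shows "smooth_on T (\<lambda>x. (f x, g x))"
proof -
  have "bounded_linear (\<lambda>a::'e. (a, 0::'f))" "bounded_linear (\<lambda>b::'f. (0::'e, b))"
    by (intro bounded_linear_Pair bounded_linear_ident bounded_linear_zero)+
  then have "smooth_on T (\<lambda>x. (f x, 0::'f))" "smooth_on T (\<lambda>x. (0::'e, g x))"
    using assms Ck_on_bounded_linear[OF T] by (force simp: smooth_on_def)+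
  from smooth_on_add[OF T this] show ?thesis by simp
qed

lemma Ck_on_cosh_sinh:
  fixes T :: "(real \<times> 'e::euclidean_space) set"
  assumes T: "open T"
  shows "Ck_on k T (\<lambda>z. a * cosh (2 * fst z) + b * sinh (2 * fst z))"
proof (induction k arbitrary: a b)
  case 0
  then show ?case by (auto intro!: continuous_intros)
next
  case (Suc k)
  show ?case
  proof (rule Ck_on_SucI[OF T])
    fix x :: "real \<times> 'e"
    have c: "((\<lambda>z. 2 * fst z) has_derivative (\<lambda>v. 2 * fst v)) (at x)"
      by (auto intro!: derivative_eq_intros)
    have d: "(cosh has_real_derivative sinh y) (at y)" "(sinh has_real_derivative cosh y) (at y)" for y :: real
      by (auto intro!: derivative_eq_intros)
    show "((\<lambda>z. a * cosh (2 * fst z) + b * sinh (2 * fst z)) has_derivative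
       (\<lambda>v. (2 * b * fst v) * cosh (2 * fst x) + (2 * a * fst v) * sinh (2 * fst x))) (at x)"
      by (rule has_derivative_eq_rhs[OF has_derivative_add[OF
            has_derivative_mult_right[OF DERIV_compose_FDERIV[OF d(1) c]]
            has_derivative_mult_right[OF DERIV_compose_FDERIV[OF d(2) c]]]])
         (simp add: algebra_simps fun_eq_iff)
  qed (rule Suc)
qed

lemma smooth_on_cosh: "open T \<Longrightarrow> smooth_on T (\<lambda>z::real\<times>'e::euclidean_space. cosh (2 * fst z))"
  and smooth_on_sinh: "open T \<Longrightarrow> smooth_on T (\<lambda>z::real\<times>'e::euclidean_space. sinh (2 * fst z))"
  using Ck_on_cosh_sinh[of T _ 1 0] Ck_on_cosh_sinh[of T _ 0 1] by (auto simp: smooth_on_def)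

lemmas smooth_on_fst = smooth_on_linear[OF _ bounded_linear_fst]
lemmas smooth_on_snd = smooth_on_linear[OF _ bounded_linear_snd]

lemma second_countable_prod:
  assumes "second_countable_space X" "second_countable_space Y"
  shows "second_countable_space (prod_topology X Y)"
proof -
  obtain A where A: "countable A" "\<forall>V\<in>A. openin X V"
      "\<forall>U x. openin X U \<and> x \<in> U \<longrightarrow> (\<exists>V\<in>A. x \<in> V \<and> V \<subseteq> U)"
    using assms(1) unfolding second_countable_space_def by (elim exE conjE)
  obtain B where B: "countable B" "\<forall>V\<in>B. openin Y V"
      "\<forall>U x. openin Y U \<and> x \<in> U \<longrightarrow> (\<exists>V\<in>B. x \<in> V \<and> V \<subseteq> U)"
    using assms(2) unfolding second_countable_space_def by (elim exE conjE)
  let ?C = "(\<lambda>(V, W). V \<times> W) ` (A \<times> B)"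
  have "\<exists>V\<in>?C. z \<in> V \<and> V \<subseteq> U" if U: "openin (prod_topology X Y) U" "z \<in> U" for U z
  proof -
    obtain x y where z: "z = (x, y)" by (cases z)
    have "\<exists>V W. openin X V \<and> openin Y W \<and> x \<in> V \<and> y \<in> W \<and> V \<times> W \<subseteq> U"
      using U(1)[unfolded openin_prod_topology_alt, rule_format, of x y] U(2) z by simp
    then obtain V W where VW: "openin X V" "openin Y W" "x \<in> V" "y \<in> W" "V \<times> W \<subseteq> U"
      by (elim exE conjE)
    obtain V' where V': "V' \<in> A" "x \<in> V'" "V' \<subseteq> V"
      using A(3)[rule_format, of V x] VW by auto
    obtain W' where W': "W' \<in> B" "y \<in> W'" "W' \<subseteq> W"
      using B(3)[rule_format, of W y] VW by auto
    have "V' \<times> W' \<subseteq> U" using Sigma_mono[OF V'(3) W'(3)] VW(5) by (rule subset_trans)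
    moreover have "V' \<times> W' \<in> ?C" using imageI[of "(V', W')" "A \<times> B" "\<lambda>(V, W). V \<times> W"] V'(1) W'(1) by simp
    moreover have "z \<in> V' \<times> W'" using V'(2) W'(2) z by simp
    ultimately show ?thesis by blast
  qed
  moreover have "countable ?C" using A(1) B(1) by simp
  moreover have "\<forall>V\<in>?C. openin (prod_topology X Y) V"
    using A(2) B(2) by (auto simp: openin_prod_Times_iff)
  ultimately show ?thesis unfolding second_countable_space_def by (intro exI[of _ ?C] conjI allI impI) auto
qed

lemma second_countable_euclidean: "second_countable_space (top_of_set (S :: real set))"
proof -
  obtain B :: "real set set" where B: "countable B" "topological_basis B"
    using ex_countable_basis by blast
  define C where "C = (\<lambda>V. S \<inter> V) ` B"
  have "\<exists>W\<in>C. x \<in> W \<and> W \<subseteq> U" if U: "openin (top_of_set S) U" "x \<in> U" for U x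
  proof -
    obtain T where T: "open T" "U = S \<inter> T" using U(1) unfolding openin_open by (elim exE conjE)
    then have x: "x \<in> S" "x \<in> T" using U(2) by simp_all
    obtain V where V: "V \<in> B" "x \<in> V" "V \<subseteq> T"
      using topological_basisE[OF B(2) T(1) x(2)] .
    have "S \<inter> V \<in> C" unfolding C_def using V(1) by (rule imageI)
    moreover have "x \<in> S \<inter> V" "S \<inter> V \<subseteq> U" using T(2) V x by auto
    ultimately show ?thesis by blast
  qed
  moreover have "\<forall>W\<in>C. openin (top_of_set S) W"
    unfolding C_def using topological_basis_open[OF B(2)] by (simp add: openin_open_Int)
  moreover have "countable C" using B(1) by (simp add: C_def)
  ultimately show ?thesis unfolding second_countable_space_def by (intro exI[of _ C] conjI allI impI) auto
qed

context
  fixes N :: "('a, 'i, 'e::euclidean_space) manifold"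
  assumes N: "smooth_manifold N"
begin

lemma chart_inj: "i \<in> charts N \<Longrightarrow> inj_on (cmap N i) (cdom N i)"
  and chart_open: "i \<in> charts N \<Longrightarrow> open (cimg N i)"
  and chart_homeo: "i \<in> charts N \<Longrightarrow>
        homeomorphic_map (subtopology (mtop N) (cdom N i)) (top_of_set (cimg N i)) (cmap N i)"
  and chart_openin: "i \<in> charts N \<Longrightarrow> openin (mtop N) (cdom N i)"
proof -
  assume i: "i \<in> charts N"
  show h: "homeomorphic_map (subtopology (mtop N) (cdom N i)) (top_of_set (cimg N i)) (cmap N i)"
    and o: "openin (mtop N) (cdom N i)" and "open (cimg N i)"
    using N i by (auto simp: smooth_manifold_def)
  show "inj_on (cmap N i) (cdom N i)"
    using homeomorphic_imp_injective_map[OF h] openin_subset[OF o]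
    by (simp add: Int_absorb1)
qed

lemma overlap_open:
  assumes i: "i \<in> charts N" and j: "j \<in> charts N"
  shows "open (overlap N i j)"
proof -
  have "openin (subtopology (mtop N) (cdom N i)) (cdom N i \<inter> cdom N j)"
    using chart_openin[OF j] by (rule openin_subtopology_Int2)
  then have "openin (top_of_set (cimg N i)) (overlap N i j)"
    using homeomorphic_imp_open_map[OF chart_homeo[OF i]] by (simp add: open_map_def overlap_def)
  then show ?thesis by (rule openin_open_trans[OF _ chart_open[OF i]])
qed

lemma overlap_subset: "overlap N i j \<subseteq> cimg N i"
  by (auto simp: overlap_def cimg_def)

lemma S_cimg: "cimg (S_manifold N) i = {0<..} \<times> cimg N i"
  by (auto simp: cimg_def S_manifold_def image_iff)

lemma S_overlap: "overlap (S_manifold N) i j = {0<..} \<times> overlap N i j"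
  by (auto simp: overlap_def S_manifold_def image_iff)

lemma S_transition:
  assumes i: "i \<in> charts N" and z: "z \<in> {0<..} \<times> cimg N i"
  shows "transition (S_manifold N) i j z = (fst z, transition N i j (snd z))"
proof -
  obtain p where p: "p \<in> cdom N i" "snd z = cmap N i p" using z by (auto simp: cimg_def)
  have "inj_on (\<lambda>(t, p). (t, cmap N i p)) ({0<..} \<times> cdom N i)"
    using chart_inj[OF i] by (auto simp: inj_on_def)
  then have "inv_into ({0<..} \<times> cdom N i) (\<lambda>(t, p). (t, cmap N i p)) z = (fst z, p)"
    using z p by (intro inv_into_f_eq) (auto simp: prod_eq_iff)
  then show ?thesis
    using p inv_into_f_f[OF chart_inj[OF i] p(1)] by (simp add: transition_def S_manifold_def)
qed

lemma S_transition_overlap: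
  assumes i: "i \<in> charts N" and z: "z \<in> {0<..} \<times> overlap N i j"
  shows "transition (S_manifold N) i j z = (fst z, transition N i j (snd z))"
  by (rule S_transition[OF i]) (use z overlap_subset[of i j] in blast)

lemma S_tangent_transition:
  assumes i: "i \<in> charts N" and j: "j \<in> charts N" and z: "z \<in> overlap (S_manifold N) i j"
  shows "tangent_transition (S_manifold N) i j z w
     = (fst w, tangent_transition N i j (snd z) (snd w))"
proof -
  let ?T = "{0<..} \<times> overlap N i j :: (real \<times> 'e) set"
  have T: "open ?T" using overlap_open[OF i j] by (intro open_Times) auto
  have zT: "z \<in> ?T" using z S_overlap by auto
  have "smooth_on (overlap N i j) (transition N i j)" using N i j by (auto simp: smooth_manifold_def)
  then have "(transition N i j has_derivative tangent_transition N i j (snd z)) (at (snd z))"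
    unfolding tangent_transition_def by (rule smooth_on_has_derivative) (use zT in \<open>simp add: mem_Times_iff\<close>)
  then have "((\<lambda>z. (fst z, transition N i j (snd z))) has_derivative
      (\<lambda>w. (fst w, tangent_transition N i j (snd z) (snd w)))) (at z)"
    by (rule has_derivative_Pair[OF bounded_linear_imp_has_derivative[OF bounded_linear_fst]
          has_derivative_compose[OF bounded_linear_imp_has_derivative[OF bounded_linear_snd]]])
  then have "(transition (S_manifold N) i j has_derivative
      (\<lambda>w. (fst w, tangent_transition N i j (snd z) (snd w)))) (at z)"
    by (rule has_derivative_transform_within_open[OF _ T zT])
       (rule S_transition_overlap[OF i, symmetric])
  from frechet_derivative_at[OF this, symmetric] show ?thesis
    by (simp add: tangent_transition_def)
qed

lemma smooth_manifold_S: "smooth_manifold (S_manifold N)"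
  unfolding smooth_manifold_def
proof (intro conjI ballI)
  show "Hausdorff_space (mtop (S_manifold N))"
    using N Hausdorff_space_subtopology[OF Hausdorff_space_euclidean, of "{0::real<..}"]
    by (simp add: smooth_manifold_def S_manifold_def Hausdorff_space_prod_topology)
  show "second_countable_space (mtop (S_manifold N))"
    using N by (simp add: smooth_manifold_def S_manifold_def second_countable_prod second_countable_euclidean)
  have u: "(\<Union>i\<in>charts N. cdom N i) = topspace (mtop N)" using N by (auto simp: smooth_manifold_def)
  show "(\<Union>i\<in>charts (S_manifold N). cdom (S_manifold N) i) = topspace (mtop (S_manifold N))"
    by (auto simp: S_manifold_def u[symmetric])
  fix i assume "i \<in> charts (S_manifold N)"
  then have i: "i \<in> charts N" by (simp add: S_manifold_def)
  show "openin (mtop (S_manifold N)) (cdom (S_manifold N) i)"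
    using chart_openin[OF i] by (auto simp: S_manifold_def openin_prod_Times_iff)
  show "open (cimg (S_manifold N) i)"
    unfolding S_cimg using chart_open[OF i] by (intro open_Times) auto
  obtain f' where f': "homeomorphic_maps (subtopology (mtop N) (cdom N i)) (top_of_set (cimg N i)) (cmap N i) f'"
    using chart_homeo[OF i] by (auto simp: homeomorphic_map_maps)
  have hm: "homeomorphic_maps (prod_topology (top_of_set {0<..}) (subtopology (mtop N) (cdom N i)))
      (prod_topology (top_of_set {0<..}) (top_of_set (cimg N i)))
      (\<lambda>(t :: real, p). (id t, cmap N i p)) (\<lambda>(t, p). (id t, f' p))"
    using f' by (subst homeomorphic_maps_prod) (auto simp: homeomorphic_maps_id)
  have e1: "prod_topology (top_of_set {0<..}) (top_of_set (cimg N i)) = top_of_set ({0<..} \<times> cimg N i)"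
    by (rule prod_topology_subtopology_eu)
  have e2: "prod_topology (top_of_set {0<..}) (subtopology (mtop N) (cdom N i))
      = subtopology (mtop (S_manifold N)) (cdom (S_manifold N) i)"
    by (simp add: S_manifold_def subtopology_Times subtopology_subtopology)
  have "homeomorphic_map (prod_topology (top_of_set {0<..}) (subtopology (mtop N) (cdom N i)))
      (prod_topology (top_of_set {0<..}) (top_of_set (cimg N i)))
      (\<lambda>(t :: real, p). (t, cmap N i p))"
    using hm by (auto simp: homeomorphic_map_maps)
  then show "homeomorphic_map (subtopology (mtop (S_manifold N)) (cdom (S_manifold N) i))
      (top_of_set (cimg (S_manifold N) i)) (cmap (S_manifold N) i)"
    unfolding S_cimg e1[symmetric] e2[symmetric] by (simp add: S_manifold_def)
next
  fix i j assume "i \<in> charts (S_manifold N)" "j \<in> charts (S_manifold N)"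
  then have i: "i \<in> charts N" and j: "j \<in> charts N" by (auto simp: S_manifold_def)
  let ?T = "{0<..} \<times> overlap N i j :: (real \<times> 'e) set"
  have T: "open ?T" using overlap_open[OF i j] by (intro open_Times) auto
  have s: "smooth_on (overlap N i j) (transition N i j)" using N i j by (auto simp: smooth_manifold_def)
  have "smooth_on ?T (\<lambda>z. (fst z, transition N i j (snd z)))"
    by (intro smooth_on_Pair[OF T] smooth_on_fst[OF T] smooth_on_compose_linear[OF T bounded_linear_snd _ s]) auto
  then show "smooth_on (overlap (S_manifold N) i j) (transition (S_manifold N) i j)"
    unfolding S_overlap
    by (rule smooth_on_cong[OF T]) (rule S_transition_overlap[OF i, symmetric])
qed

end

lemma riemannian_metric_levi_civita:
  assumes M: "smooth_manifold M" and g: "riemannian_metric M g" and i: "i \<in> charts M" and x: "x \<in> cimg M i"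
  shows "is_levi_civita_at (g i) x (levi_civita (g i) x)"
proof -
  have "\<exists>!\<Gamma>. is_levi_civita_at (g i) x \<Gamma>"
  proof (rule levi_civita_unique_ex[OF chart_open[OF M i] x])
    show "(\<lambda>y. g i y u v) differentiable (at x)" for u v
      using g i x smooth_on_has_derivative[of "cimg M i" "\<lambda>y. g i y u v" x]
      by (auto simp: riemannian_metric_def differentiable_def)
  qed (use g i x in \<open>auto simp: riemannian_metric_def\<close>)
  then show ?thesis unfolding levi_civita_def by (rule theI')
qed

lemma DIM_sum_real: "(\<Sum>b\<in>Basis. f (b :: real \<times> 'e::euclidean_space)) = f (1, 0) + (\<Sum>b\<in>Basis. f (0, b))"
proof -
  have B: "(Basis :: (real \<times> 'e) set) = insert (1, 0) ((\<lambda>b. (0, b)) ` Basis)"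
    by (auto simp: Basis_prod_def)
  have n: "(1::real, 0::'e) \<notin> (\<lambda>b. (0, b)) ` Basis" by auto
  show ?thesis
    by (subst B, subst sum.insert[OF _ n]) (simp_all add: sum.reindex inj_on_def)
qed

lemma apapR_S_manifold:
  fixes N :: "('a, 'i, 'e::euclidean_space) manifold"
  assumes A: "almost_paracomplex_riemannian N P h"
  shows "apapR_manifold (S_manifold N) (S_phi P) S_xi S_eta (S_metric P h)"
proof -
  have N: "smooth_manifold N" and dim: "\<exists>n\<ge>1. DIM('e) = 2 * n"
    and P: "endomorphism_field N P" and h: "riemannian_metric N h"
    using A by (auto simp: almost_paracomplex_riemannian_def)
  have ch: "charts (S_manifold N) = charts N" by (simp add: S_manifold_def)
  note op = chart_open[OF smooth_manifold_S[OF N], unfolded ch]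
  note tt = S_tangent_transition[OF N]
  have tr: "transition (S_manifold N) i j z = (fst z, transition N i j (snd z))"
    if "i \<in> charts N" "z \<in> overlap (S_manifold N) i j" for i j z
    using S_transition[OF N that(1), of z] overlap_subset[OF N] that(2) S_overlap[OF N]
    by (auto simp: mem_Times_iff)
  have PP: "P i x (P i x u) = u" "trace_of (P i x) = 0" "h i x (P i x u) (P i x v) = h i x u v"
    and Pl: "linear (P i x)" and hb: "bilinear (h i x)" and hs: "h i x u v = h i x v u"
    and hp: "u \<noteq> 0 \<Longrightarrow> 0 < h i x u u"
    if "i \<in> charts N" "x \<in> cimg N i" for i x u v
    using A that by (auto simp: almost_paracomplex_riemannian_def endomorphism_field_def riemannian_metric_def)
  have Ps: "smooth_on (cimg N i) (\<lambda>x. P i x u)" and hsm: "smooth_on (cimg N i) (\<lambda>x. h i x u v)"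
    if "i \<in> charts N" for i u v
    using P h that by (auto simp: endomorphism_field_def riemannian_metric_def)
  have lift: "smooth_on (cimg (S_manifold N) i) (\<lambda>z. f (snd z))"
    if "i \<in> charts N" "smooth_on (cimg N i) f" for i and f :: "'e \<Rightarrow> 'f::real_normed_vector"
    by (rule smooth_on_compose_linear[OF op bounded_linear_snd _ that(2)]) (use that in \<open>auto simp: S_cimg[OF N]\<close>)
  show ?thesis
    unfolding apapR_manifold_def
  proof (intro conjI ballI allI)
    show "smooth_manifold (S_manifold N)" by (rule smooth_manifold_S[OF N])
    show "\<exists>n\<ge>1. DIM(real \<times> 'e) = 2 * n + 1" using dim by auto
    show "endomorphism_field (S_manifold N) (S_phi P)"
      unfolding endomorphism_field_def ch
    proof (intro conjI ballI allI)
      fix i z u assume i: "i \<in> charts N"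
      show "linear (S_phi P i z)" if "z \<in> cimg (S_manifold N) i"
        using Pl[OF i, of "snd z"] that
        by (auto simp: S_phi_def S_cimg[OF N] split_beta linear_iff)
      show "smooth_on (cimg (S_manifold N) i) (\<lambda>x. S_phi P i x u)"
        by (auto simp: S_phi_def split_beta intro!: smooth_on_Pair[OF op[OF i]] smooth_on_const[OF op[OF i]]
            lift[OF i Ps[OF i]])
      fix j assume j: "j \<in> charts N" and z: "z \<in> overlap (S_manifold N) i j"
      then show "S_phi P j (transition (S_manifold N) i j z) (tangent_transition (S_manifold N) i j z u)
          = tangent_transition (S_manifold N) i j z (S_phi P i z u)"
        using P i S_overlap[OF N, of i j]
        by (auto simp: tr tt S_phi_def split_beta endomorphism_field_def mem_Times_iff)
    qed
    have t0: "tangent_transition N i j x 0 = 0" if "i \<in> charts N" "j \<in> charts N" "x \<in> overlap N i j" for i j x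
    proof -
      have "smooth_on (overlap N i j) (transition N i j)"
        using N that by (auto simp: smooth_manifold_def)
      then have "linear (tangent_transition N i j x)"
        unfolding tangent_transition_def using that(3) smooth_on_has_derivative has_derivative_linear by blast
      then show ?thesis by (rule linear_0)
    qed
    have xi: "S_xi = (\<lambda>i z. (1, 0))" by (auto simp: S_xi_def fun_eq_iff)
    show "vector_field (S_manifold N) S_xi"
      unfolding vector_field_def ch
      by (auto simp: xi split_beta tt t0 S_overlap[OF N] intro!: smooth_on_const op)
    show "one_form (S_manifold N) S_eta"
      unfolding one_form_def ch
      by (auto simp: S_eta_def split_beta tt linear_iff S_overlap[OF N] intro!: smooth_on_const op)
    show "riemannian_metric (S_manifold N) (S_metric P h)"
      unfolding riemannian_metric_def ch
    proof (intro conjI ballI allI impI)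
      fix i and z u v :: "real \<times> 'e" assume i: "i \<in> charts N"
      {
        assume "z \<in> cimg (S_manifold N) i"
        then have z: "snd z \<in> cimg N i" "0 < fst z" by (auto simp: S_cimg[OF N])
        let ?x = "snd z" and ?t = "2 * fst z"
        note b = hb[OF i z(1)] and l = Pl[OF i z(1)]
        note s = bilinear_ladd[OF b] bilinear_radd[OF b] bilinear_lmul[OF b] bilinear_rmul[OF b]
           linear_add[OF l] linear_scale[OF l]
        show "bilinear (S_metric P h i z)"
          by (auto simp: bilinear_def linear_iff S_metric_def paracomplex_assoc_def split_beta s algebra_simps)
        have sy: "h i ?x a (P i ?x c) = h i ?x c (P i ?x a)" for a c
          using PP(3)[OF i z(1), of a "P i ?x c"] by (simp add: PP(1)[OF i z(1)] hs[OF i z(1), of c])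
        show "S_metric P h i z u v = S_metric P h i z v u"
          using sy hs[OF i z(1)] by (auto simp: S_metric_def paracomplex_assoc_def split_beta)
        assume "u \<noteq> 0"
        have pos: "0 < cosh ?t * h i ?x a a + sinh ?t * h i ?x a (P i ?x a)" if "a \<noteq> 0" for a
        proof -
          have nn: "0 \<le> h i ?x c c" for c
            using hp[OF i z(1), of c] bilinear_lzero[OF b, of c] by (cases "c = 0") auto
          have "h i ?x (a - P i ?x a) (a - P i ?x a) \<ge> 0"
               "h i ?x (a + P i ?x a) (a + P i ?x a) \<ge> 0"
            using nn by blast+
          then have ab: "\<bar>h i ?x a (P i ?x a)\<bar> \<le> h i ?x a a"
            using PP(3)[OF i z(1), of a a] hs[OF i z(1), of a "P i ?x a"]
            by (simp add: bilinear_lsub[OF b] bilinear_rsub[OF b] s)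
          have sh: "0 \<le> sinh ?t" "sinh ?t < cosh ?t" using z(2) by (auto simp: sinh_less_cosh_real)
          have "sinh ?t * \<bar>h i ?x a (P i ?x a)\<bar> \<le> sinh ?t * h i ?x a a"
            using ab sh by (intro mult_left_mono) auto
          also have "\<dots> < cosh ?t * h i ?x a a" using sh hp[OF i z(1) that] by simp
          finally have "\<bar>sinh ?t * h i ?x a (P i ?x a)\<bar> < cosh ?t * h i ?x a a"
            using sh(1) by (simp add: abs_mult)
          then show ?thesis by linarith
        qed
        show "0 < S_metric P h i z u u"
        proof (cases "snd u = 0")
          case True
          then have "fst u \<noteq> 0" using \<open>u \<noteq> 0\<close> by (auto simp: prod_eq_iff)
          then have "0 < fst u * fst u" using not_real_square_gt_zero by blast
          then show ?thesis using True bilinear_lzero[OF b]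
            by (simp add: S_metric_def paracomplex_assoc_def split_beta)
        next
          case False
          then show ?thesis using pos[OF False] zero_le_square[of "fst u"]
            unfolding S_metric_def paracomplex_assoc_def split_beta by linarith
        qed
      }
      have hP: "smooth_on (cimg N i) (\<lambda>x. h i x (snd u) (P i x (snd v)))"
      proof (rule smooth_on_cong)
        show "smooth_on (cimg N i) (\<lambda>x. \<Sum>b\<in>Basis. (P i x (snd v) \<bullet> b) * h i x (snd u) b)"
          using chart_open[OF N i] Ps[OF i] hsm[OF i]
          by (intro smooth_on_sum smooth_on_mult smooth_on_inner smooth_on_const) auto
        fix x assume x: "x \<in> cimg N i"
        have l: "linear (h i x (snd u))" using hb[OF i x] by (simp add: bilinear_def)
        show "(\<Sum>b\<in>Basis. (P i x (snd v) \<bullet> b) * h i x (snd u) b) = h i x (snd u) (P i x (snd v))"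
          using linear_sum[OF l, of "\<lambda>b. (P i x (snd v) \<bullet> b) *\<^sub>R b" Basis]
          by (simp add: linear_scale[OF l] euclidean_representation)
      qed (rule chart_open[OF N i])
      show "smooth_on (cimg (S_manifold N) i) (\<lambda>z. S_metric P h i z u v)"
        unfolding S_metric_def paracomplex_assoc_def split_beta
        by (intro smooth_on_add smooth_on_mult smooth_on_const smooth_on_cosh smooth_on_sinh
            op[OF i] lift[OF i] hP hsm[OF i])
      fix j assume j: "j \<in> charts N" and z: "z \<in> overlap (S_manifold N) i j"
      then have z2: "snd z \<in> overlap N i j" by (auto simp: S_overlap[OF N])
      have "P j (transition N i j (snd z)) (tangent_transition N i j (snd z) w)
          = tangent_transition N i j (snd z) (P i (snd z) w)" for w
        using P i j z2 by (auto simp: endomorphism_field_def)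
      moreover have "h j (transition N i j (snd z)) (tangent_transition N i j (snd z) w)
          (tangent_transition N i j (snd z) w') = h i (snd z) w w'" for w w'
        using h i j z2 by (auto simp: riemannian_metric_def)
      ultimately show "S_metric P h j (transition (S_manifold N) i j z) (tangent_transition (S_manifold N) i j z u)
            (tangent_transition (S_manifold N) i j z v) = S_metric P h i z u v"
        using tr[OF i z] tt[OF i j z]
        by (simp add: S_metric_def paracomplex_assoc_def split_beta)
    qed
    fix i z u v assume "i \<in> charts (S_manifold N)" "z \<in> cimg (S_manifold N) i"
    then have i: "i \<in> charts N" and z: "snd z \<in> cimg N i" by (auto simp: ch S_cimg[OF N])
    note q = PP[OF i z] linear_0[OF Pl[OF i z]]
    show "S_phi P i z (S_phi P i z u) = u - S_eta i z u *\<^sub>R S_xi i z"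
      "S_eta i z (S_xi i z) = 1" "S_eta i z (S_phi P i z u) = 0" "S_phi P i z (S_xi i z) = 0"
      by (auto simp: S_phi_def S_eta_def S_xi_def split_beta q prod_eq_iff)
    show "trace_of (S_phi P i z) = 0"
      using q(2) by (simp add: trace_of_def DIM_sum_real S_phi_def split_beta)
    show "S_metric P h i z (S_phi P i z u) (S_phi P i z v) = S_metric P h i z u v - S_eta i z u * S_eta i z v"
      by (simp add: S_metric_def S_phi_def S_eta_def paracomplex_assoc_def split_beta q)
  qed
qed

end

theory Submission
  imports Defs
begin

text \<open>
  Write \<open>h\<^sub>t = cosh 2t h + sinh 2t h(\<cdot>, P \<cdot>)\<close>, so that \<open>g = dt\<^sup>2 + h\<^sub>t\<close>.  Each \<open>h\<^sub>t\<close> is again a metric for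
  which \<open>P\<close> is an isometry, and \<open>\<partial>\<^sub>t h\<^sub>t = 2 h\<^sub>t(P \<cdot>, \<cdot>)\<close>: the slices \<open>t = const\<close> have \<open>P\<close> as shape operator.
  The Levi-Civita connection of \<open>g\<close> is therefore
    \<open>\<nabla>\<^bsub>(a, u)\<^esub> (b, v) = (- h\<^sub>t(Pu, v), a Pv + b Pu + \<Gamma>\<^sub>t(u, v))\<close>
  with \<open>\<Gamma>\<^sub>t\<close> the connection of \<open>h\<^sub>t\<close> (lemma \<open>levi_civita_product\<close>).

  From a curvature identity to \<open>\<nabla>P = 0\<close>: by the Codazzi equation, \<open>R((0, u), (0, v)) \<xi>\<close> is the
  vector \<open>C(u, v) = (\<nabla>\<^sup>t\<^sub>u P) v - (\<nabla>\<^sup>t\<^sub>v P) u\<close>.  Hence \<open>\<rho>((0, v), \<xi>)\<close> and \<open>\<rho>\<^sup>*((0, v), \<xi>)\<close> are the traces of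
  \<open>C(\<cdot>, v)\<close> and \<open>P C(\<cdot>, v)\<close>, and the two formulas force the respective trace to vanish.  On a
  surface an alternating vector-valued form with vanishing traces is zero, so \<open>C = 0\<close>
  and \<open>h\<^sub>t((\<nabla>\<^sup>t\<^sub>u P) v, w)\<close> is totally symmetric; since \<open>\<nabla>\<^sup>t\<^sub>u P\<close> anticommutes with \<open>P\<close>, it vanishes
  (\<open>codazzi_imp_parallel\<close>).  Finally \<open>h\<close> is built from \<open>h\<^sub>t\<close> in the way \<open>h\<^bsub>-t\<^esub>\<close> is built from \<open>h\<close>,
  so a \<open>P\<close> that is parallel for \<open>h\<^sub>t\<close> is parallel for \<open>h\<close> (\<open>parallel_if_slice_parallel\<close>).
  A single value of \<open>t\<close> suffices in this direction.

  From \<open>\<nabla>P = 0\<close> to the curvature identities: now \<open>\<Gamma>\<^sub>t = \<Gamma>\<close> for all \<open>t\<close>, and the curvature of \<open>h\<close> is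
  skew and commutes with \<open>P\<close>.  On a surface the centralizer of \<open>P\<close> consists of symmetric
  operators, so \<open>h\<close> is flat (\<open>parallel_imp_flat\<close>) and \<open>k' = 0\<close>.  The curvature of \<open>g\<close> is then explicit
  (\<open>parallel_curvature_product\<close>), and its traces are \<open>\<rho> = -2 \<eta> \<otimes> \<eta>\<close> and
  \<open>\<rho>\<^sup>* = - g(\<cdot>, \<phi> \<cdot>)\<close>, which is what the two formulas say for \<open>k' = 0\<close>.
\<close>

section \<open>Symmetry of second derivatives and fields of linear maps\<close>

text \<open>The double difference of \<open>f\<close> over a parallelogram is estimated by the mean value theorem, first
  along \<open>u\<close> and then along \<open>v\<close>.  It does not change when \<open>u\<close> and \<open>v\<close> are exchanged, which is the source of
  the symmetry of second derivatives.\<close>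

lemma double_difference_mvt:
  fixes f :: "'e::real_normed_vector \<Rightarrow> real"
  assumes U: "open U" and s: "0 < s"
    and seg: "\<And>a b. 0 \<le> a \<Longrightarrow> a \<le> s \<Longrightarrow> 0 \<le> b \<Longrightarrow> b \<le> s \<Longrightarrow> x + a *\<^sub>R u + b *\<^sub>R v \<in> U"
    and f: "\<And>y. y \<in> U \<Longrightarrow> f differentiable (at y)"
    and fu: "\<And>y. y \<in> U \<Longrightarrow> (\<lambda>y. frechet_derivative f (at y) u) differentiable (at y)"
  shows "\<exists>a b. 0 \<le> a \<and> a \<le> s \<and> 0 \<le> b \<and> b \<le> s \<and>
     f (x + s *\<^sub>R u + s *\<^sub>R v) - f (x + s *\<^sub>R u) - f (x + s *\<^sub>R v) + f x
       = s\<^sup>2 * frechet_derivative (\<lambda>y. frechet_derivative f (at y) u) (at (x + a *\<^sub>R u + b *\<^sub>R v)) v"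
proof -
  define F where "F y = frechet_derivative f (at y) u" for y
  have df: "(f has_derivative frechet_derivative f (at y)) (at y)"
    and dF: "(F has_derivative frechet_derivative F (at y)) (at y)" if "y \<in> U" for y
    using f[OF that] fu[OF that] unfolding F_def frechet_derivative_works by blast+
  have A: "((\<lambda>a. f (x + a *\<^sub>R u + b *\<^sub>R v)) has_real_derivative F (x + a *\<^sub>R u + b *\<^sub>R v)) (at a)"
    if "0 \<le> a" "a \<le> s" "0 \<le> b" "b \<le> s" for a b
    unfolding has_field_derivative_def F_def
    by (rule has_derivative_eq_rhs[OF has_derivative_compose[where g = f and f = "\<lambda>a. x + a *\<^sub>R u + b *\<^sub>R v", OF _ df[OF seg[OF that]]]])
       (auto intro!: derivative_eq_intros ext
         simp: linear_scale[OF has_derivative_linear[OF df[OF seg[OF that]]]])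
  have B: "((\<lambda>b. F (x + a *\<^sub>R u + b *\<^sub>R v)) has_real_derivative
       frechet_derivative F (at (x + a *\<^sub>R u + b *\<^sub>R v)) v) (at b)"
    if "0 \<le> a" "a \<le> s" "0 \<le> b" "b \<le> s" for a b
    unfolding has_field_derivative_def
    by (rule has_derivative_eq_rhs[OF has_derivative_compose[where g = F and f = "\<lambda>b. x + a *\<^sub>R u + b *\<^sub>R v", OF _ dF[OF seg[OF that]]]])
       (auto intro!: derivative_eq_intros ext
         simp: linear_scale[OF has_derivative_linear[OF dF[OF seg[OF that]]]])
  have "\<exists>a. 0 < a \<and> a < s \<and>
      (f (x + s *\<^sub>R u + s *\<^sub>R v) - f (x + s *\<^sub>R u + 0 *\<^sub>R v))
       - (f (x + 0 *\<^sub>R u + s *\<^sub>R v) - f (x + 0 *\<^sub>R u + 0 *\<^sub>R v))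
      = (s - 0) * (F (x + a *\<^sub>R u + s *\<^sub>R v) - F (x + a *\<^sub>R u + 0 *\<^sub>R v))"
    by (rule MVT2[OF s]) (use s in \<open>auto intro!: DERIV_diff A simp del: scaleR_zero_left add_0_right\<close>)
  then obtain a where a: "0 < a" "a < s" and a_eq:
     "f (x + s *\<^sub>R u + s *\<^sub>R v) - f (x + s *\<^sub>R u) - f (x + s *\<^sub>R v) + f x
       = s * (F (x + a *\<^sub>R u + s *\<^sub>R v) - F (x + a *\<^sub>R u + 0 *\<^sub>R v))"
    by (auto simp: algebra_simps)
  have "\<exists>b. 0 < b \<and> b < s \<and>
      F (x + a *\<^sub>R u + s *\<^sub>R v) - F (x + a *\<^sub>R u + 0 *\<^sub>R v)
      = (s - 0) * frechet_derivative F (at (x + a *\<^sub>R u + b *\<^sub>R v)) v"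
    by (rule MVT2[OF s]) (use s a in \<open>auto intro!: B\<close>)
  then obtain b where "0 < b" "b < s"
    "F (x + a *\<^sub>R u + s *\<^sub>R v) - F (x + a *\<^sub>R u + 0 *\<^sub>R v)
      = s * frechet_derivative F (at (x + a *\<^sub>R u + b *\<^sub>R v)) v"
    by auto
  with a a_eq show ?thesis
    by (intro exI[of _ a] exI[of _ b]) (simp add: F_def[abs_def] power2_eq_square)
qed

text \<open>The double difference divided by \<open>s\<^sup>2\<close> is a value near \<open>x\<close> of either mixed derivative; by
  continuity these agree at \<open>x\<close>.\<close>

lemma second_derivative_symmetric_real:
  fixes f :: "'e::euclidean_space \<Rightarrow> real"
  assumes U: "open U" "x \<in> U" and f: "smooth_on U f"
  shows "frechet_derivative (\<lambda>y. frechet_derivative f (at y) u) (at x) v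
       = frechet_derivative (\<lambda>y. frechet_derivative f (at y) v) (at x) u"
proof -
  define H where "H u v y = frechet_derivative (\<lambda>y. frechet_derivative f (at y) u) (at y) v" for u v y
  have f2: "Ck_on 2 U f" using f by (simp add: smooth_on_def)
  have d1: "f differentiable (at y)"
    and d2: "(\<lambda>y. frechet_derivative f (at y) u) differentiable (at y)" if "y \<in> U" for y u
    using f2 that by (auto simp: numeral_2_eq_2)
  have cont: "continuous_on U (H u v)" for u v
    using f2 unfolding H_def by (auto simp: numeral_2_eq_2)
  have lim: "\<exists>d>0. \<forall>y. dist y x < d \<longrightarrow> y \<in> U \<and> \<bar>H u v y - H u v x\<bar> < e" if e: "0 < e" for e u v
  proof -
    have "isCont (H u v) x" using cont U by (simp add: continuous_on_eq_continuous_at)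
    then obtain d where d: "0 < d" "\<forall>y. dist y x < d \<longrightarrow> dist (H u v y) (H u v x) < e"
      using e unfolding continuous_at_eps_delta by metis
    obtain d' where d': "0 < d'" "\<forall>y. dist y x < d' \<longrightarrow> y \<in> U" using U unfolding open_dist by metis
    show ?thesis using d d' by (intro exI[of _ "min d d'"]) (auto simp: dist_real_def)
  qed
  have "\<bar>H u v x - H v u x\<bar> < 2 * e" if e: "0 < e" for e
  proof -
    obtain d1 where d1': "0 < d1" "\<forall>y. dist y x < d1 \<longrightarrow> y \<in> U \<and> \<bar>H u v y - H u v x\<bar> < e"
      using lim[OF e] by blast
    obtain d2 where d2': "0 < d2" "\<forall>y. dist y x < d2 \<longrightarrow> y \<in> U \<and> \<bar>H v u y - H v u x\<bar> < e"
      using lim[OF e] by blast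
    \<comment> \<open>small enough for the whole parallelogram to lie in both neighbourhoods\<close>
    define s where "s = min d1 d2 / (2 * (norm u + norm v + 1))"
    have nn: "0 < norm u + norm v + 1" by (smt (verit) norm_ge_zero)
    then have s: "0 < s" using d1' d2' by (simp add: s_def)
    have near: "dist (x + a *\<^sub>R p + b *\<^sub>R q) x < min d1 d2"
      if "0 \<le> a" "a \<le> s" "0 \<le> b" "b \<le> s" "norm p + norm q = norm u + norm v" for a b p q
    proof -
      have "dist (x + a *\<^sub>R p + b *\<^sub>R q) x = norm (a *\<^sub>R p + b *\<^sub>R q)" by (simp add: dist_norm)
      also have "\<dots> \<le> norm (a *\<^sub>R p) + norm (b *\<^sub>R q)" by (rule norm_triangle_ineq)
      also have "\<dots> = a * norm p + b * norm q" using that by simp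
      also have "\<dots> \<le> s * norm p + s * norm q"
        using that by (intro add_mono mult_right_mono) auto
      also have "\<dots> = s * (norm u + norm v)" by (simp flip: that(5) add: algebra_simps)
      also have "\<dots> \<le> s * (norm u + norm v + 1)" using s by simp
      also have "\<dots> = min d1 d2 / 2" using nn by (simp add: s_def field_simps)
      also have "\<dots> < min d1 d2" using d1'(1) d2'(1) by linarith
      finally show ?thesis .
    qed
    have uv: "norm v + norm u = norm u + norm v" by simp
    obtain a b where ab: "0 \<le> a" "a \<le> s" "0 \<le> b" "b \<le> s"
      "f (x + s *\<^sub>R u + s *\<^sub>R v) - f (x + s *\<^sub>R u) - f (x + s *\<^sub>R v) + f x = s\<^sup>2 * H u v (x + a *\<^sub>R u + b *\<^sub>R v)"
      using double_difference_mvt[OF U(1) s _ d1 d2, of x u v] near[OF _ _ _ _ refl] d1' unfolding H_def by force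
    obtain a' b' where ab': "0 \<le> a'" "a' \<le> s" "0 \<le> b'" "b' \<le> s"
      "f (x + s *\<^sub>R v + s *\<^sub>R u) - f (x + s *\<^sub>R v) - f (x + s *\<^sub>R u) + f x = s\<^sup>2 * H v u (x + a' *\<^sub>R v + b' *\<^sub>R u)"
      using double_difference_mvt[OF U(1) s _ d1 d2, of x v u] near[OF _ _ _ _ uv] d1' unfolding H_def by force
    have "s\<^sup>2 * H u v (x + a *\<^sub>R u + b *\<^sub>R v) = s\<^sup>2 * H v u (x + a' *\<^sub>R v + b' *\<^sub>R u)"
      using ab(5) ab'(5) by (simp add: algebra_simps)
    then have "H u v (x + a *\<^sub>R u + b *\<^sub>R v) = H v u (x + a' *\<^sub>R v + b' *\<^sub>R u)" using s by simp
    moreover have "\<bar>H u v (x + a *\<^sub>R u + b *\<^sub>R v) - H u v x\<bar> < e"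
      using d1' near[OF ab(1-4) refl] by simp
    moreover have "\<bar>H v u (x + a' *\<^sub>R v + b' *\<^sub>R u) - H v u x\<bar> < e"
      using d2' near[OF ab'(1-4) uv] by simp
    ultimately show ?thesis by linarith
  qed
  from this[of "\<bar>H u v x - H v u x\<bar> / 2"] have "H u v x = H v u x" by fastforce
  then show ?thesis by (simp add: H_def)
qed

lemma frechet_derivative_inner_const:
  assumes "f differentiable (at x)"
  shows "frechet_derivative (\<lambda>y. f y \<bullet> b) (at x) v = frechet_derivative f (at x) v \<bullet> b"
  using frechet_derivative_at[OF has_derivative_inner_left[OF assms[unfolded frechet_derivative_works], of b]]
  by metis

lemma second_derivative_symmetric:
  fixes f :: "'e::euclidean_space \<Rightarrow> 'f::euclidean_space"
  assumes U: "open U" "x \<in> U" and f: "smooth_on U f"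
  shows "frechet_derivative (\<lambda>y. frechet_derivative f (at y) u) (at x) v
       = frechet_derivative (\<lambda>y. frechet_derivative f (at y) v) (at x) u"
proof (rule euclidean_eqI)
  fix b :: 'f
  have f2: "Ck_on 2 U f" using f by (simp add: smooth_on_def)
  have d1: "f differentiable (at y)"
    and d2: "(\<lambda>y. frechet_derivative f (at y) u) differentiable (at y)" if "y \<in> U" for y u
    using f2 that by (auto simp: numeral_2_eq_2)
  have e: "frechet_derivative (\<lambda>y. frechet_derivative (\<lambda>y. f y \<bullet> b) (at y) u) (at x) v
      = frechet_derivative (\<lambda>y. frechet_derivative f (at y) u) (at x) v \<bullet> b" for u v
  proof -
    have "((\<lambda>y. frechet_derivative f (at y) u \<bullet> b) has_derivative
        (\<lambda>v. frechet_derivative (\<lambda>y. frechet_derivative f (at y) u) (at x) v \<bullet> b)) (at x)"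
      using d2[OF U(2)] unfolding frechet_derivative_works by (rule has_derivative_inner_left)
    then have "((\<lambda>y. frechet_derivative (\<lambda>y. f y \<bullet> b) (at y) u) has_derivative
        (\<lambda>v. frechet_derivative (\<lambda>y. frechet_derivative f (at y) u) (at x) v \<bullet> b)) (at x)"
      by (rule has_derivative_transform_within_open[OF _ U]) (simp add: frechet_derivative_inner_const d1)
    then show ?thesis by (metis frechet_derivative_at)
  qed
  show "frechet_derivative (\<lambda>y. frechet_derivative f (at y) u) (at x) v \<bullet> b
       = frechet_derivative (\<lambda>y. frechet_derivative f (at y) v) (at x) u \<bullet> b"
    using second_derivative_symmetric_real[OF U smooth_on_inner[OF U(1) f smooth_on_const[OF U(1)]], of b u v]
    by (simp add: e)
qed

text \<open>Product rule for the application of a point-dependent linear map to a vector field.  Only the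
  derivatives along constant vectors are given; the expansion of \<open>Y\<close> in the fixed basis reduces the
  general case to them.\<close>

lemma has_derivative_linear_field:
  fixes f :: "'d::real_normed_vector \<Rightarrow> 'e::euclidean_space \<Rightarrow> 'f::real_normed_vector"
  assumes U: "open U" "x \<in> U" and lin: "\<And>y. y \<in> U \<Longrightarrow> linear (f y)"
    and d: "\<And>v. ((\<lambda>y. f y v) has_derivative D v) (at x)"
    and Y: "(Y has_derivative Y') (at x)"
  shows "((\<lambda>y. f y (Y y)) has_derivative (\<lambda>u. D (Y x) u + f x (Y' u))) (at x)"
proof -
  have rep: "f y v = (\<Sum>b\<in>Basis. (v \<bullet> b) *\<^sub>R f y b)" if "y \<in> U" for y v
    using linear_sum[OF lin[OF that], of "\<lambda>b. (v \<bullet> b) *\<^sub>R b" Basis]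
    by (simp add: linear_scale[OF lin[OF that]] euclidean_representation)
  have "((\<lambda>y. \<Sum>b\<in>Basis. (v \<bullet> b) *\<^sub>R f y b) has_derivative (\<lambda>u. \<Sum>b\<in>Basis. (v \<bullet> b) *\<^sub>R D b u)) (at x)" for v
    by (intro has_derivative_sum has_derivative_scaleR_right d)
  then have "((\<lambda>y. f y v) has_derivative (\<lambda>u. \<Sum>b\<in>Basis. (v \<bullet> b) *\<^sub>R D b u)) (at x)" for v
    by (rule has_derivative_transform_within_open[OF _ U]) (simp add: rep)
  then have D: "D v u = (\<Sum>b\<in>Basis. (v \<bullet> b) *\<^sub>R D b u)" for v u
    using has_derivative_unique[OF d] by metis
  have "((\<lambda>y. \<Sum>b\<in>Basis. (Y y \<bullet> b) *\<^sub>R f y b) has_derivative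
      (\<lambda>u. \<Sum>b\<in>Basis. (Y x \<bullet> b) *\<^sub>R D b u + (Y' u \<bullet> b) *\<^sub>R f x b)) (at x)"
    by (intro has_derivative_sum has_derivative_scaleR has_derivative_inner_left d Y)
  then have "((\<lambda>y. \<Sum>b\<in>Basis. (Y y \<bullet> b) *\<^sub>R f y b) has_derivative (\<lambda>u. D (Y x) u + f x (Y' u))) (at x)"
    by (simp add: sum.distrib D[of "Y x"] rep[OF U(2), of "Y' _"])
  then show ?thesis
    by (rule has_derivative_transform_within_open[OF _ U]) (simp add: rep)
qed

lemma has_derivative_comp_snd:
  assumes "(f has_derivative f') (at x)"
  shows "((\<lambda>z. f (snd z)) has_derivative (\<lambda>w. f' (snd w))) (at (t, x))"
  using has_derivative_compose[where x = "(t, x)" and s = UNIV and f = snd and f' = snd and g = f and g' = f'] assms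
  by (simp add: bounded_linear_imp_has_derivative bounded_linear_snd)

lemma linear_frechet_derivative_field:
  fixes f :: "'d::real_normed_vector \<Rightarrow> 'e::real_normed_vector \<Rightarrow> 'f::real_normed_vector"
  assumes U: "open U" "x \<in> U" and lin: "\<And>y. y \<in> U \<Longrightarrow> linear (f y)"
    and d: "\<And>v. (\<lambda>y. f y v) differentiable (at x)"
  shows "linear (\<lambda>v. frechet_derivative (\<lambda>y. f y v) (at x) u)"
proof (rule linearI)
  note d' = d[unfolded frechet_derivative_works]
  fix a b r
  have "((\<lambda>y. f y (a + b)) has_derivative
      (\<lambda>u. frechet_derivative (\<lambda>y. f y a) (at x) u + frechet_derivative (\<lambda>y. f y b) (at x) u)) (at x)"
    by (rule has_derivative_transform_within_open[OF has_derivative_add[OF d' d'] U]) (simp add: linear_add[OF lin])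
  then show "frechet_derivative (\<lambda>y. f y (a + b)) (at x) u
      = frechet_derivative (\<lambda>y. f y a) (at x) u + frechet_derivative (\<lambda>y. f y b) (at x) u"
    by (simp flip: frechet_derivative_at)
  have "((\<lambda>y. f y (r *\<^sub>R a)) has_derivative (\<lambda>u. r *\<^sub>R frechet_derivative (\<lambda>y. f y a) (at x) u)) (at x)"
    by (rule has_derivative_transform_within_open[OF has_derivative_scaleR_right[OF d'] U]) (simp add: linear_scale[OF lin])
  then show "frechet_derivative (\<lambda>y. f y (r *\<^sub>R a)) (at x) u = r *\<^sub>R frechet_derivative (\<lambda>y. f y a) (at x) u"
    by (simp flip: frechet_derivative_at)
qed

section \<open>Riemannian metrics in a chart\<close>

text \<open>The connection depends on the germ of the metric only.\<close>

lemma is_levi_civita_at_cong: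
  assumes U: "open U" "x \<in> U" and eq: "\<And>y u v. y \<in> U \<Longrightarrow> G y u v = G' y u v"
    and G: "is_levi_civita_at G x \<Gamma>" and diff: "\<And>u v. (\<lambda>y. G y u v) differentiable (at x)"
  shows "is_levi_civita_at G' x \<Gamma>"
proof -
  have "((\<lambda>y. G' y u v) has_derivative frechet_derivative (\<lambda>y. G y u v) (at x)) (at x)" for u v
    by (rule has_derivative_transform_within_open[OF diff[unfolded frechet_derivative_works] U]) (simp add: eq)
  from frechet_derivative_at[OF this, symmetric] show ?thesis
    using G U by (simp add: is_levi_civita_at_def eq)
qed

text \<open>The coordinate components of a Riemannian metric on the range of one chart.\<close>

locale riemannian_chart =
  fixes U :: "'e::euclidean_space set" and G :: "'e \<Rightarrow> 'e \<Rightarrow> 'e \<Rightarrow> real"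
  assumes open_U: "open U"
    and bilinear_G: "x \<in> U \<Longrightarrow> bilinear (G x)"
    and sym: "x \<in> U \<Longrightarrow> G x u v = G x v u"
    and pos: "x \<in> U \<Longrightarrow> u \<noteq> 0 \<Longrightarrow> 0 < G x u u"
    and G_differentiable: "x \<in> U \<Longrightarrow> (\<lambda>y. G y u v) differentiable (at x)"
begin

lemmas G_simps = bilinear_ladd[OF bilinear_G] bilinear_radd[OF bilinear_G]
  bilinear_lsub[OF bilinear_G] bilinear_rsub[OF bilinear_G]
  bilinear_lmul[OF bilinear_G] bilinear_rmul[OF bilinear_G]
  bilinear_lneg[OF bilinear_G] bilinear_rneg[OF bilinear_G]
  bilinear_lzero[OF bilinear_G] bilinear_rzero[OF bilinear_G]

lemma nondegenerate:
  assumes "x \<in> U" "\<And>z. G x a z = G x b z"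
  shows "a = b"
proof (rule ccontr)
  assume "a \<noteq> b"
  then have "0 < G x (a - b) (a - b)" by (intro pos[OF assms(1)]) simp
  then show False using assms(2)[of "a - b"] by (simp add: bilinear_lsub[OF bilinear_G[OF assms(1)]])
qed

lemma levi_civita_ex1: "x \<in> U \<Longrightarrow> \<exists>!\<Gamma>. is_levi_civita_at G x \<Gamma>"
  by (rule levi_civita_unique_ex[OF open_U _ bilinear_G sym pos G_differentiable])

lemma is_levi_civita: "x \<in> U \<Longrightarrow> is_levi_civita_at G x (levi_civita G x)"
  unfolding levi_civita_def by (rule theI'[OF levi_civita_ex1])

lemma levi_civita_eqI: "x \<in> U \<Longrightarrow> is_levi_civita_at G x \<Gamma> \<Longrightarrow> levi_civita G x = \<Gamma>"
  by (rule the1_equality[OF levi_civita_ex1, folded levi_civita_def])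

lemma levi_civita_bilinear: "x \<in> U \<Longrightarrow> bilinear (levi_civita G x)"
  and levi_civita_commute: "x \<in> U \<Longrightarrow> levi_civita G x u v = levi_civita G x v u"
  and levi_civita_metric: "x \<in> U \<Longrightarrow> frechet_derivative (\<lambda>y. G y u v) (at x) w
      = G x (levi_civita G x w u) v + G x u (levi_civita G x w v)"
  using is_levi_civita[of x] unfolding is_levi_civita_at_def by blast+

lemmas levi_civita_simps =
  bilinear_ladd[OF levi_civita_bilinear] bilinear_radd[OF levi_civita_bilinear]
  bilinear_lsub[OF levi_civita_bilinear] bilinear_rsub[OF levi_civita_bilinear]
  bilinear_lmul[OF levi_civita_bilinear] bilinear_rmul[OF levi_civita_bilinear]
  bilinear_lneg[OF levi_civita_bilinear] bilinear_rneg[OF levi_civita_bilinear]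
  bilinear_lzero[OF levi_civita_bilinear] bilinear_rzero[OF levi_civita_bilinear]

text \<open>\<open>u g(Y, Z) = g(\<nabla>\<^sub>u Y, Z) + g(Y, \<nabla>\<^sub>u Z)\<close> for vector fields \<open>Y\<close>, \<open>Z\<close> with non-constant components.\<close>

lemma has_derivative_metric:
  assumes x: "x \<in> U" and Y: "(Y has_derivative Y') (at x)" and Z: "(Z has_derivative Z') (at x)"
  shows "((\<lambda>y. G y (Y y) (Z y)) has_derivative
     (\<lambda>u. G x (Y' u + levi_civita G x u (Y x)) (Z x) + G x (Y x) (Z' u + levi_civita G x u (Z x)))) (at x)"
proof -
  have c: "((\<lambda>y. G y u v) has_derivative
      (\<lambda>w. G x (levi_civita G x w u) v + G x u (levi_civita G x w v))) (at x)" for u v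
    using G_differentiable[OF x, of u v] unfolding frechet_derivative_works
    by (rule has_derivative_eq_rhs) (simp add: levi_civita_metric[OF x] fun_eq_iff)
  have "((\<lambda>y. G y u (Z y)) has_derivative
      (\<lambda>w. G x (levi_civita G x w u) (Z x) + G x u (levi_civita G x w (Z x)) + G x u (Z' w))) (at x)" for u
    by (rule has_derivative_linear_field[OF open_U x _ c Z]) (use bilinear_G in \<open>simp add: bilinear_def\<close>)
  from has_derivative_linear_field[where f = "\<lambda>y u. G y u (Z y)", OF open_U x _ this Y] show ?thesis
    by (rule has_derivative_eq_rhs) (use bilinear_G in \<open>simp add: bilinear_def\<close>, simp add: G_simps x fun_eq_iff)
qed

text \<open>The row of the inverse matrix with index \<open>i\<close> is the vector metrically dual to the coordinate
  form \<open>z \<mapsto> z \<bullet> i\<close>; this avoids any calculation with matrices.\<close>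

lemma inverse_metric_sharp:
  assumes x: "x \<in> U" and i: "i \<in> Basis"
  obtains a where "\<And>j. inverse_metric G x i j = a \<bullet> j" "\<And>z. G x z a = z \<bullet> i"
proof -
  let ?Q = "\<lambda>a. \<forall>k\<in>Basis. (\<Sum>j\<in>Basis. (a \<bullet> j) * G x j k) = (if i = k then 1 else 0)"
  have lin: "linear (\<lambda>u. G x u z)" for z using bilinear_G[OF x] by (simp add: bilinear_def)
  have rep: "(\<Sum>j\<in>Basis. (a \<bullet> j) * G x j k) = G x a k" for a k
    using linear_sum[OF lin, of "\<lambda>b. (a \<bullet> b) *\<^sub>R b" Basis]
    by (simp add: linear_scale[OF lin] euclidean_representation)
  have Q: "?Q a \<longleftrightarrow> (\<forall>z. G x a z = z \<bullet> i)" for a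
  proof
    assume Q: "?Q a"
    have "linear (G x a)" using bilinear_G[OF x] by (simp add: bilinear_def)
    then have "G x a z = z \<bullet> i" for z
    proof (rule linear_eq_on_span[where B = Basis])
      show "linear (\<lambda>z. z \<bullet> i)" by (rule linearI) (simp_all add: inner_add_left)
      show "G x a k = k \<bullet> i" if "k \<in> Basis" for k
        using Q[rule_format, OF that] unfolding rep by (auto simp: inner_Basis that i)
    qed simp
    then show "\<forall>z. G x a z = z \<bullet> i" by blast
  qed (auto simp: rep inner_Basis i)
  have "\<exists>!a. \<forall>z. G x a z = z \<bullet> i"
    by (rule riesz_pos_def[OF bilinear_G[OF x] pos[OF x]]) (auto intro: linearI inner_add_left)
  then have ex: "\<exists>!a. ?Q a" unfolding Q .
  define a where "a = (THE a. ?Q a)"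
  have "?Q a" unfolding a_def by (rule theI'[OF ex])
  then have "G x a z = z \<bullet> i" for z unfolding Q by blast
  then show thesis
    by (intro that[of a]) (simp_all only: inverse_metric_def a_def sym[OF x, of _ a, unfolded a_def])
qed

text \<open>With this lemma the Ricci tensors become traces of endomorphisms, in which neither the inverse
  metric nor a choice of frame occurs.\<close>

lemma contract_inverse_metric:
  assumes x: "x \<in> U"
  shows "(\<Sum>i\<in>Basis. \<Sum>j\<in>Basis. inverse_metric G x i j * G x (L i) j) = trace_of L"
  unfolding trace_of_def
proof (rule sum.cong[OF refl])
  fix i :: 'e assume "i \<in> Basis"
  then obtain a where a: "\<And>j. inverse_metric G x i j = a \<bullet> j" "\<And>z. G x z a = z \<bullet> i"
    using inverse_metric_sharp[OF x] by blast
  have lin: "linear (G x (L i))" using bilinear_G[OF x] by (simp add: bilinear_def)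
  show "(\<Sum>j\<in>Basis. inverse_metric G x i j * G x (L i) j) = L i \<bullet> i"
    using linear_sum[OF lin, of "\<lambda>b. (a \<bullet> b) *\<^sub>R b" Basis]
    by (simp add: linear_scale[OF lin] euclidean_representation a)
qed

lemma ricci_eq_trace: "x \<in> U \<Longrightarrow> ricci G x y z = trace_of (\<lambda>u. curvature G x u y z)"
  unfolding ricci_def curvature4_def by (rule contract_inverse_metric)

lemma ricci_star_eq_trace:
  assumes x: "x \<in> U" and adj: "\<And>u v. G x u (\<phi> x v) = G x (\<phi> x u) v"
  shows "ricci_star G \<phi> x y z = trace_of (\<lambda>u. \<phi> x (curvature G x u y z))"
  unfolding ricci_star_def curvature4_def adj by (rule contract_inverse_metric[OF x])

lemma curvature_eq:
  assumes x: "x \<in> U"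
  shows "curvature G x u v w =
      frechet_derivative (\<lambda>y. levi_civita G y v w) (at x) u + levi_civita G x u (levi_civita G x v w)
      - (frechet_derivative (\<lambda>y. levi_civita G y u w) (at x) v + levi_civita G x v (levi_civita G x u w))"
proof -
  have "covariant_derivative (levi_civita G) (\<lambda>_. v) (\<lambda>_. w) = (\<lambda>y. levi_civita G y v w)" for v
    by (simp add: fun_eq_iff covariant_derivative_def)
  then show ?thesis
    by (simp add: curvature_def curvature_operator_def covariant_derivative_def lie_bracket_def
        levi_civita_simps x)
qed

lemma has_derivative_levi_civita:
  assumes x: "x \<in> U" and \<Gamma>: "\<And>v w. (\<lambda>y. levi_civita G y v w) differentiable (at x)"
    and Y: "(Y has_derivative Y') (at x)"
  shows "((\<lambda>y. levi_civita G y v (Y y)) has_derivative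
     (\<lambda>u. frechet_derivative (\<lambda>y. levi_civita G y v (Y x)) (at x) u + levi_civita G x v (Y' u))) (at x)"
  by (rule has_derivative_linear_field[OF open_U x _ _ Y])
     (use levi_civita_bilinear in \<open>simp add: bilinear_def\<close>, use \<Gamma> in \<open>simp add: frechet_derivative_works\<close>)

text \<open>The second derivative of the function \<open>g(w, w)\<close> is symmetric; expressed by the connection, its
  antisymmetric part is \<open>2 g(R(u, v) w, w)\<close>.\<close>

lemma curvature_skew:
  assumes x: "x \<in> U" and smooth: "\<And>w. smooth_on U (\<lambda>y. G y w w)"
    and \<Gamma>: "\<And>v w. (\<lambda>y. levi_civita G y v w) differentiable (at x)"
  shows "G x (curvature G x u v w) w = 0"
proof -
  let ?q = "\<lambda>y. G y w w" and ?\<Gamma> = "levi_civita G"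
  have D2: "frechet_derivative (\<lambda>y. frechet_derivative ?q (at y) v) (at x) u
      = 2 * (G x (frechet_derivative (\<lambda>y. ?\<Gamma> y v w) (at x) u + ?\<Gamma> x u (?\<Gamma> x v w)) w
             + G x (?\<Gamma> x v w) (?\<Gamma> x u w))" for u v
  proof -
    have "((\<lambda>y. 2 * G y (?\<Gamma> y v w) w) has_derivative (\<lambda>u.
        2 * (G x (frechet_derivative (\<lambda>y. ?\<Gamma> y v w) (at x) u + ?\<Gamma> x u (?\<Gamma> x v w)) w
             + G x (?\<Gamma> x v w) (0 + ?\<Gamma> x u w)))) (at x)"
      by (intro has_derivative_mult_right has_derivative_metric[OF x] has_derivative_const
          \<Gamma>[unfolded frechet_derivative_works])
    then have "((\<lambda>y. frechet_derivative ?q (at y) v) has_derivative (\<lambda>u.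
        2 * (G x (frechet_derivative (\<lambda>y. ?\<Gamma> y v w) (at x) u + ?\<Gamma> x u (?\<Gamma> x v w)) w
             + G x (?\<Gamma> x v w) (0 + ?\<Gamma> x u w)))) (at x)"
      by (rule has_derivative_transform_within_open[OF _ open_U x])
         (simp add: levi_civita_metric sym[of _ w])
    then show ?thesis by (simp flip: frechet_derivative_at)
  qed
  have "frechet_derivative (\<lambda>y. frechet_derivative ?q (at y) v) (at x) u
      = frechet_derivative (\<lambda>y. frechet_derivative ?q (at y) u) (at x) v"
    by (rule second_derivative_symmetric[OF open_U x smooth])
  then show ?thesis
    unfolding D2 curvature_eq[OF x] by (simp add: G_simps x sym[OF x, of "?\<Gamma> x v w"])
qed

lemma linear_curvature:
  assumes x: "x \<in> U" and \<Gamma>: "\<And>v w. (\<lambda>y. levi_civita G y v w) differentiable (at x)"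
  shows "linear (curvature G x u v)"
proof -
  have "linear (\<lambda>w. frechet_derivative (\<lambda>y. levi_civita G y v w) (at x) u)" for u v
    by (rule linear_frechet_derivative_field[OF open_U x _ \<Gamma>]) (use levi_civita_bilinear in \<open>simp add: bilinear_def\<close>)
  note lin = linear_add[OF this] linear_scale[OF this]
  show ?thesis
    by (rule linearI) (simp_all add: curvature_eq x lin levi_civita_simps algebra_simps)
qed

end

section \<open>Traces\<close>

lemma trace_of_add: "trace_of (\<lambda>u. A u + B u) = trace_of A + trace_of B"
  and trace_of_diff: "trace_of (\<lambda>u. A u - B u) = trace_of A - trace_of B"
  and trace_of_scaleR: "trace_of (\<lambda>u. r *\<^sub>R A u) = r * trace_of A"
  by (simp_all add: trace_of_def inner_simps sum.distrib sum_subtractf sum_distrib_left)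

lemma trace_of_id: "trace_of (\<lambda>u::'e::euclidean_space. u) = DIM('e)"
  by (simp add: trace_of_def)

lemma trace_of_rank_one:
  assumes "linear f"
  shows "trace_of (\<lambda>u. f u *\<^sub>R z) = f z"
  using linear_sum[OF assms, of "\<lambda>b. (z \<bullet> b) *\<^sub>R b" Basis]
  by (simp add: trace_of_def linear_scale[OF assms] euclidean_representation mult.commute)

lemma trace_of_prod:
  "trace_of (L :: real \<times> 'e::euclidean_space \<Rightarrow> real \<times> 'e) = fst (L (1, 0)) + trace_of (\<lambda>u. snd (L (0, u)))"
  by (simp add: trace_of_def DIM_sum_real inner_prod_def)

lemma vec2_decompose: "(v :: real^2) = v $ 1 *\<^sub>R axis 1 1 + v $ 2 *\<^sub>R axis 2 1"
  by (simp add: vec_eq_iff forall_2 axis_def)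

lemma trace_of_2: "trace_of (A :: real^2 \<Rightarrow> real^2) = A (axis 1 1) $ 1 + A (axis 2 1) $ 2"
proof -
  have B: "(Basis :: (real^2) set) = {axis 1 1, axis 2 1}"
    by (auto simp: Basis_vec_def UNIV_2)
  have n: "(axis 1 1 :: real^2) \<noteq> axis 2 1" by (simp add: axis_eq_axis)
  show ?thesis by (simp add: trace_of_def B n inner_axis)
qed

text \<open>In dimension 2 an alternating form is \<open>C(u, v) = \<omega>(u, v) c\<close> with an area form \<open>\<omega>\<close>, and the trace of
  \<open>C(\<cdot>, v)\<close> is \<open>\<omega>(c, v)\<close>; so the traces determine \<open>c\<close>.\<close>

lemma alternating_traceless_eq_0:
  fixes C :: "real^2 \<Rightarrow> real^2 \<Rightarrow> real^2"
  assumes bil: "bilinear C" and alt: "\<And>u v. C u v = - C v u" and tr: "\<And>v. trace_of (\<lambda>u. C u v) = 0"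
  shows "C u v = 0"
proof -
  have diag: "C u u = 0" for u using alt[of u u] by (simp add: eq_neg_iff_add_eq_0 flip: scaleR_2)
  have "C (axis 1 1) (axis 2 1) $ 1 = 0"
    using tr[of "axis 2 1"] by (simp add: trace_of_2 diag)
  moreover have "C (axis 1 1) (axis 2 1) $ 2 = 0"
    using tr[of "axis 1 1"] alt[of "axis 1 1" "axis 2 1"] by (simp add: trace_of_2 diag)
  ultimately have 12: "C (axis 1 1) (axis 2 1) = 0" by (simp add: vec_eq_iff forall_2)
  then have 21: "C (axis 2 1) (axis 1 1) = 0" using alt[of "axis 2 1" "axis 1 1"] by simp
  show ?thesis
    by (subst vec2_decompose[of u], subst vec2_decompose[of v])
       (simp add: bilinear_ladd[OF bil] bilinear_radd[OF bil] bilinear_lmul[OF bil] bilinear_rmul[OF bil] diag 12 21)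
qed

section \<open>Differentiability of the connection of a surface\<close>

text \<open>Cramer's rule for the Gram matrix: the vector field dual to a differentiable one-form is
  differentiable.\<close>

lemma differentiable_metric_dual_2:
  fixes G :: "real^2 \<Rightarrow> real^2 \<Rightarrow> real^2 \<Rightarrow> real"
  assumes "riemannian_chart U G" and x: "x \<in> U"
    and K: "\<And>z. (\<lambda>y. K y z) differentiable (at x)" and w: "\<And>y z. y \<in> U \<Longrightarrow> G y (w y) z = K y z"
  shows "w differentiable (at x)"
proof -
  interpret riemannian_chart U G by fact
  let ?e = "axis 1 1 :: real^2" and ?f = "axis 2 1 :: real^2"
  define d where "d y = G y ?e ?e * G y ?f ?f - G y ?e ?f * G y ?e ?f" for y
  have d: "0 < d y" if y: "y \<in> U" for y
  proof -
    \<comment> \<open>the component of \<open>f\<close> orthogonal to \<open>e\<close>, scaled; its length exhibits the Gram determinant\<close>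
    let ?u = "G y ?e ?e *\<^sub>R ?f - G y ?e ?f *\<^sub>R ?e"
    have e: "0 < G y ?e ?e" by (rule pos[OF y]) (simp add: axis_eq_0_iff)
    have "?u $ 2 \<noteq> 0" using e by (simp add: axis_def)
    then have "?u \<noteq> 0" by (metis zero_index)
    then have "0 < G y ?u ?u" by (rule pos[OF y])
    also have "\<dots> = G y ?e ?e * d y"
      by (simp add: G_simps y d_def sym[OF y, of ?f ?e] algebra_simps)
    finally show ?thesis using e by (simp add: zero_less_mult_iff)
  qed
  have cramer: "w y = ((K y ?e * G y ?f ?f - K y ?f * G y ?e ?f) / d y) *\<^sub>R ?e
      + ((K y ?f * G y ?e ?e - K y ?e * G y ?e ?f) / d y) *\<^sub>R ?f" if y: "y \<in> U" for y
  proof -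
    have "K y z = w y $ 1 * G y ?e z + w y $ 2 * G y ?f z" for z
      by (subst w[OF y, symmetric], subst vec2_decompose[of "w y"]) (simp add: G_simps y)
    then have "K y ?e * G y ?f ?f - K y ?f * G y ?e ?f = w y $ 1 * d y"
      "K y ?f * G y ?e ?e - K y ?e * G y ?e ?f = w y $ 2 * d y"
      by (simp_all add: d_def sym[OF y, of ?f ?e] algebra_simps)
    then show ?thesis using d[OF y] by (subst vec2_decompose[of "w y"]) simp
  qed
  have "(\<lambda>y. ((K y ?e * G y ?f ?f - K y ?f * G y ?e ?f) / d y) *\<^sub>R ?e
      + ((K y ?f * G y ?e ?e - K y ?e * G y ?e ?f) / d y) *\<^sub>R ?f) differentiable (at x)"
    using d[OF x] unfolding d_def
    by (intro differentiable_add differentiable_scaleR differentiable_divide differentiable_diff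
        differentiable_mult K G_differentiable[OF x] differentiable_const) auto
  then obtain D where "((\<lambda>y. ((K y ?e * G y ?f ?f - K y ?f * G y ?e ?f) / d y) *\<^sub>R ?e
      + ((K y ?f * G y ?e ?e - K y ?e * G y ?e ?f) / d y) *\<^sub>R ?f) has_derivative D) (at x)"
    unfolding differentiable_def ..
  then have "(w has_derivative D) (at x)"
    by (rule has_derivative_transform_within_open[OF _ open_U x]) (simp add: cramer)
  then show ?thesis by (rule differentiableI)
qed

text \<open>By the Koszul formula the connection is dual to a combination of first derivatives of the metric.\<close>

lemma levi_civita_differentiable_2:
  fixes G :: "real^2 \<Rightarrow> real^2 \<Rightarrow> real^2 \<Rightarrow> real"
  assumes R: "riemannian_chart U G" and x: "x \<in> U" and smooth: "\<And>u v. smooth_on U (\<lambda>y. G y u v)"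
  shows "(\<lambda>y. levi_civita G y u v) differentiable (at x)"
proof -
  interpret riemannian_chart U G by fact
  define K where "K y z = (frechet_derivative (\<lambda>y. G y v z) (at y) u
    + frechet_derivative (\<lambda>y. G y u z) (at y) v - frechet_derivative (\<lambda>y. G y u v) (at y) z) / 2" for y z
  have koszul: "G y (levi_civita G y u v) z = K y z" if y: "y \<in> U" for y z
    by (simp add: K_def levi_civita_metric[OF y] levi_civita_commute[OF y, of v u]
        levi_civita_commute[OF y, of z] sym[OF y, of _ "levi_civita G y _ _"])
  have "(\<lambda>y. frechet_derivative (\<lambda>y. G y u v) (at y) z) differentiable (at x)" for u v z
  proof -
    have "Ck_on 2 U (\<lambda>y. G y u v)" using smooth by (simp add: smooth_on_def)
    then show ?thesis using x by (simp add: numeral_2_eq_2)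
  qed
  then have "(\<lambda>y. K y z) differentiable (at x)" for z
    unfolding K_def by (intro differentiable_divide differentiable_diff differentiable_add) auto
  from differentiable_metric_dual_2[OF R x this koszul] show ?thesis by simp
qed

section \<open>Almost paracomplex structures\<close>

text \<open>The metric is a parameter because the same lemmas are applied to \<open>h\<close> and to the metrics of all
  slices.\<close>

locale paracomplex_chart = riemannian_chart U h
  for U :: "'e::euclidean_space set" and h +
  fixes P :: "'e \<Rightarrow> 'e \<Rightarrow> 'e"
  assumes P_linear: "x \<in> U \<Longrightarrow> linear (P x)"
    and P_differentiable: "x \<in> U \<Longrightarrow> (\<lambda>y. P y v) differentiable (at x)"
    and P_P: "x \<in> U \<Longrightarrow> P x (P x v) = v"
    and P_isometry: "x \<in> U \<Longrightarrow> h x (P x u) (P x v) = h x u v"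
begin

abbreviation \<Gamma> where "\<Gamma> \<equiv> levi_civita h"
abbreviation dP where "dP x u v \<equiv> frechet_derivative (\<lambda>y. P y v) (at x) u"
abbreviation nablaP where "nablaP \<equiv> covariant_derivative_endo \<Gamma> P"

lemmas P_simps = linear_add[OF P_linear] linear_diff[OF P_linear] linear_scale[OF P_linear]
  linear_neg[OF P_linear] linear_0[OF P_linear] P_P P_isometry

lemma P_adjoint: "x \<in> U \<Longrightarrow> h x (P x u) v = h x u (P x v)"
  using P_isometry[of x u "P x v"] by (simp add: P_P)

lemma nablaP_eq: "nablaP x u v = dP x u v + \<Gamma> x u (P x v) - P x (\<Gamma> x u v)"
  by (simp add: covariant_derivative_endo_def covariant_derivative_def)

lemma has_derivative_P_const: "x \<in> U \<Longrightarrow> ((\<lambda>y. P y v) has_derivative (\<lambda>u. dP x u v)) (at x)"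
  using P_differentiable by (simp add: frechet_derivative_works)

lemma has_derivative_P:
  assumes x: "x \<in> U" and Y: "(Y has_derivative Y') (at x)"
  shows "((\<lambda>y. P y (Y y)) has_derivative (\<lambda>u. dP x u (Y x) + P x (Y' u))) (at x)"
  by (rule has_derivative_linear_field[OF open_U x P_linear has_derivative_P_const[OF x] Y])

text \<open>The derivative of \<open>P\<^sup>2 = I\<close>.\<close>

lemma nablaP_anticommutes:
  assumes x: "x \<in> U"
  shows "nablaP x u (P x v) = - P x (nablaP x u v)"
proof -
  have "((\<lambda>y. P y (P y v)) has_derivative (\<lambda>u. dP x u (P x v) + P x (dP x u v))) (at x)"
    by (rule has_derivative_P[OF x has_derivative_P_const[OF x]])
  then have "((\<lambda>y. v) has_derivative (\<lambda>u. dP x u (P x v) + P x (dP x u v))) (at x)"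
    by (rule has_derivative_transform_within_open[OF _ open_U x]) (simp add: P_P)
  from has_derivative_unique[OF this has_derivative_const]
  have "dP x u (P x v) + P x (dP x u v) = 0" by meson
  then show ?thesis
    by (simp add: nablaP_eq P_simps x add_eq_0_iff)
qed

text \<open>The derivative of \<open>h(Pv, w) = h(v, Pw)\<close>.\<close>

lemma nablaP_adjoint:
  assumes x: "x \<in> U"
  shows "h x (nablaP x u v) w = h x v (nablaP x u w)"
proof -
  have "((\<lambda>y. h y (P y v) w) has_derivative
      (\<lambda>u. h x (dP x u v + \<Gamma> x u (P x v)) w + h x (P x v) (0 + \<Gamma> x u w))) (at x)" for v w
    by (intro has_derivative_metric[OF x] has_derivative_P_const[OF x] has_derivative_const)
  note 1 = this[of v w] this[of w v]
  have "((\<lambda>y. h y (P y v) w) has_derivative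
      (\<lambda>u. h x (dP x u w + \<Gamma> x u (P x w)) v + h x (P x w) (0 + \<Gamma> x u v))) (at x)"
    by (rule has_derivative_transform_within_open[OF 1(2) open_U x]) (simp add: P_adjoint sym[of _ w])
  from has_derivative_unique[OF 1(1) this]
  have "h x (dP x u v + \<Gamma> x u (P x v)) w + h x (P x v) (0 + \<Gamma> x u w)
      = h x (dP x u w + \<Gamma> x u (P x w)) v + h x (P x w) (0 + \<Gamma> x u v)" by meson
  then show ?thesis
    using P_adjoint[OF x] sym[OF x]
    by (simp add: nablaP_eq G_simps x algebra_simps)
qed

text \<open>Under the Codazzi condition \<open>T(u, v, w) = h((\<nabla>\<^sub>u P) v, w)\<close> is totally symmetric, and moving \<open>P\<close> between the
  last two arguments changes its sign.  By symmetry this holds for any two arguments; carrying \<open>P\<close> around all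
  three of them takes an odd number of steps and gives \<open>T = - T\<close>.\<close>

lemma codazzi_imp_parallel:
  assumes x: "x \<in> U" and codazzi: "\<And>u v. nablaP x u v = nablaP x v u"
  shows "nablaP x u v = 0"
proof -
  define T where "T u v w = h x (nablaP x u v) w" for u v w
  have T12: "T u v w = T v u w" for u v w by (simp add: T_def codazzi[of u])
  have T23: "T u v w = T u w v" for u v w
    by (simp add: T_def nablaP_adjoint[OF x, of u v] sym[OF x, of v])
  have TP: "T u (P x v) w = - T u v (P x w)" for u v w
    by (simp add: T_def nablaP_anticommutes[OF x] P_adjoint[OF x] G_simps x)
  have "T u v (P x w) = - T u v (P x w)" for u v w
  proof -
    have "T u v (P x w) = - T w u (P x v)" using TP T12 T23 by metis
    also have "\<dots> = T w (P x u) v" using TP by simp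
    also have "\<dots> = T v w (P x u)" using T12 T23 by metis
    also have "\<dots> = - T u v (P x w)" using TP T12 T23 by (metis minus_minus)
    finally show ?thesis .
  qed
  then have "T u v (P x w) = 0" for u v w by (metis add.inverse_unique neg_equal_zero)
  then have "h x (nablaP x u v) z = h x 0 z" for z
    unfolding T_def by (metis P_P[OF x] bilinear_lzero[OF bilinear_G[OF x]])
  then show ?thesis by (rule nondegenerate[OF x])
qed

lemma bilinear_nablaP:
  assumes x: "x \<in> U"
  shows "bilinear (nablaP x)"
proof -
  have "linear (\<lambda>v. dP x u v)" for u
    by (rule linear_frechet_derivative_field[OF open_U x P_linear P_differentiable[OF x]])
  moreover have "linear (\<lambda>u. dP x u v)" for v
    using has_derivative_P_const[OF x] by (rule has_derivative_linear)
  ultimately show ?thesis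
    unfolding bilinear_def nablaP_eq
    by (auto simp: linear_iff levi_civita_simps P_simps x algebra_simps)
qed

text \<open>Ricci identity: for parallel \<open>P\<close> the first derivatives of \<open>P\<close> are given by the connection, and the
  symmetry of its second derivatives says that \<open>P\<close> commutes with the curvature.\<close>

lemma curvature_commutes_P:
  assumes x: "x \<in> U" and par: "\<And>y u v. y \<in> U \<Longrightarrow> nablaP y u v = 0"
    and smooth: "\<And>w. smooth_on U (\<lambda>y. P y w)"
    and \<Gamma>: "\<And>v w. (\<lambda>y. \<Gamma> y v w) differentiable (at x)"
  shows "curvature h x u v (P x w) = P x (curvature h x u v w)"
proof -
  have dP: "dP y v w = P y (\<Gamma> y v w) - \<Gamma> y v (P y w)" if "y \<in> U" for y v w
    using par[OF that, of v w] by (simp add: nablaP_eq algebra_simps)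
  have D2: "frechet_derivative (\<lambda>y. dP y v w) (at x) u
      = dP x u (\<Gamma> x v w) + P x (frechet_derivative (\<lambda>y. \<Gamma> y v w) (at x) u)
        - (frechet_derivative (\<lambda>y. \<Gamma> y v (P x w)) (at x) u + \<Gamma> x v (dP x u w))" for u v
  proof -
    have "((\<lambda>y. P y (\<Gamma> y v w) - \<Gamma> y v (P y w)) has_derivative
       (\<lambda>u. dP x u (\<Gamma> x v w) + P x (frechet_derivative (\<lambda>y. \<Gamma> y v w) (at x) u)
        - (frechet_derivative (\<lambda>y. \<Gamma> y v (P x w)) (at x) u + \<Gamma> x v (dP x u w)))) (at x)"
      by (intro has_derivative_diff has_derivative_P[OF x] has_derivative_levi_civita[OF x \<Gamma>]
          has_derivative_P_const[OF x] \<Gamma>[unfolded frechet_derivative_works])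
    then have "((\<lambda>y. dP y v w) has_derivative
       (\<lambda>u. dP x u (\<Gamma> x v w) + P x (frechet_derivative (\<lambda>y. \<Gamma> y v w) (at x) u)
        - (frechet_derivative (\<lambda>y. \<Gamma> y v (P x w)) (at x) u + \<Gamma> x v (dP x u w)))) (at x)"
      by (rule has_derivative_transform_within_open[OF _ open_U x]) (simp add: dP)
    then show ?thesis by (simp flip: frechet_derivative_at)
  qed
  have "frechet_derivative (\<lambda>y. dP y v w) (at x) u = frechet_derivative (\<lambda>y. dP y u w) (at x) v"
    by (rule second_derivative_symmetric[OF open_U x smooth])
  then show ?thesis
    unfolding D2 by (simp add: curvature_eq x dP P_simps levi_civita_simps algebra_simps)
qed

end

section \<open>The metrics of the slices\<close>

definition slice_metric ::
  "('e \<Rightarrow> 'e \<Rightarrow> 'e) \<Rightarrow> ('e \<Rightarrow> 'e \<Rightarrow> 'e \<Rightarrow> real) \<Rightarrow> real \<Rightarrow> 'e \<Rightarrow> 'e \<Rightarrow> 'e \<Rightarrow> real" where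
  "slice_metric P h t x u v = cosh (2 * t) * h x u v + sinh (2 * t) * h x u (P x v)"

context paracomplex_chart
begin

text \<open>\<open>h\<^sub>t\<close> fails to be parallel for the connection of \<open>h\<close> by a term in \<open>\<nabla>P\<close>; if \<open>P\<close> is parallel, the two
  metrics have the same connection.\<close>

lemma has_derivative_slice_const:
  assumes x: "x \<in> U"
  shows "((\<lambda>y. slice_metric P h t y u v) has_derivative
     (\<lambda>w. slice_metric P h t x (\<Gamma> x w u) v + slice_metric P h t x u (\<Gamma> x w v)
        + sinh (2 * t) * h x u (nablaP x w v))) (at x)"
proof -
  have "((\<lambda>y. cosh (2 * t) * h y u v + sinh (2 * t) * h y u (P y v)) has_derivative
     (\<lambda>w. cosh (2 * t) * (h x (0 + \<Gamma> x w u) v + h x u (0 + \<Gamma> x w v))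
        + sinh (2 * t) * (h x (0 + \<Gamma> x w u) (P x v) + h x u (dP x w v + \<Gamma> x w (P x v))))) (at x)"
    by (intro has_derivative_add has_derivative_mult_right has_derivative_metric[OF x]
        has_derivative_const has_derivative_P_const[OF x])
  then show ?thesis
    unfolding slice_metric_def
    by (rule has_derivative_eq_rhs) (simp add: fun_eq_iff nablaP_eq G_simps x algebra_simps)
qed

text \<open>Positivity: with \<open>u\<^sub>+ = u + Pu\<close> and \<open>u\<^sub>- = u - Pu\<close> one has
  \<open>4 h\<^sub>t(u, u) = exp (2t) h(u\<^sub>+, u\<^sub>+) + exp (-2t) h(u\<^sub>-, u\<^sub>-)\<close>.  This holds for all real \<open>t\<close>, which is
  what makes the passage from \<open>t\<close> to \<open>-t\<close> possible.\<close>

lemma slice_paracomplex_chart: "paracomplex_chart U (slice_metric P h t) P"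
proof (intro paracomplex_chart.intro riemannian_chart.intro paracomplex_chart_axioms.intro)
  fix x u v assume x: "x \<in> U"
  show "bilinear (slice_metric P h t x)"
    by (auto simp: bilinear_def linear_iff slice_metric_def G_simps P_simps x algebra_simps)
  show "slice_metric P h t x u v = slice_metric P h t x v u"
    by (simp add: slice_metric_def sym[OF x, of u] P_adjoint[OF x, of v])
  show "(\<lambda>y. slice_metric P h t y u v) differentiable (at x)"
    using has_derivative_slice_const[OF x] unfolding differentiable_def by blast
  show "slice_metric P h t x (P x u) (P x v) = slice_metric P h t x u v"
    by (simp add: slice_metric_def P_simps x P_adjoint)
  assume u: "u \<noteq> 0"
  have nonneg: "0 \<le> h x a a" for a using pos[OF x, of a] by (cases "a = 0") (auto simp: G_simps x)
  have "u + P x u \<noteq> 0 \<or> u - P x u \<noteq> 0"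
  proof (rule ccontr)
    assume "\<not> ?thesis"
    then have z: "u + P x u = 0" "u - P x u = 0" by blast+
    have "2 *\<^sub>R u = (u + P x u) + (u - P x u)" by (simp add: scaleR_2)
    then have "2 *\<^sub>R u = 0" by (simp only: z add_0_left)
    then show False using u by simp
  qed
  then have "0 < exp (2 * t) * h x (u + P x u) (u + P x u) + exp (- (2 * t)) * h x (u - P x u) (u - P x u)"
    using pos[OF x] nonneg by (auto intro: add_pos_nonneg add_nonneg_pos)
  also have "\<dots> = 4 * slice_metric P h t x u u"
    by (simp add: slice_metric_def cosh_def sinh_def G_simps x P_P P_adjoint field_simps)
  finally show "0 < slice_metric P h t x u u" by simp
qed (simp_all add: open_U P_linear P_differentiable P_P)

text \<open>The coefficient of \<open>h(u, v)\<close> is \<open>cosh\<^sup>2 2t - sinh\<^sup>2 2t = 1\<close> and the mixed terms cancel.  So the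
  construction can be inverted: \<open>h\<close> is a slice of each \<open>h\<^sub>t\<close>.\<close>

lemma slice_slice: "x \<in> U \<Longrightarrow> slice_metric P (slice_metric P h t) (- t) x u v = h x u v"
  using cosh_square_eq[of "2 * t"]
  by (simp add: slice_metric_def P_P power2_eq_square algebra_simps flip: distrib_right)

lemma levi_civita_slice_parallel:
  assumes x: "x \<in> U" and par: "\<And>u v. nablaP x u v = 0"
  shows "levi_civita (slice_metric P h t) x = \<Gamma> x"
proof -
  interpret slice: paracomplex_chart U "slice_metric P h t" P by (rule slice_paracomplex_chart)
  have "is_levi_civita_at (slice_metric P h t) x (\<Gamma> x)"
    unfolding is_levi_civita_at_def
  proof (intro conjI allI)
    show "frechet_derivative (\<lambda>y. slice_metric P h t y u v) (at x) w
        = slice_metric P h t x (\<Gamma> x w u) v + slice_metric P h t x u (\<Gamma> x w v)" for u v w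
      using frechet_derivative_at[OF has_derivative_slice_const[OF x, of t u v], symmetric]
      by (simp add: par G_simps x)
  qed (use levi_civita_bilinear levi_civita_commute x in blast)+
  then show ?thesis by (rule slice.levi_civita_eqI[OF x])
qed

text \<open>\<open>levi_civita_slice_parallel\<close> is applied to \<open>h\<^sub>t\<close> and its slice \<open>h\<close>.\<close>

lemma parallel_if_slice_parallel:
  assumes x: "x \<in> U"
    and par: "\<And>u v. covariant_derivative_endo (levi_civita (slice_metric P h t)) P x u v = 0"
  shows "nablaP x u v = 0"
proof -
  interpret slice: paracomplex_chart U "slice_metric P h t" P by (rule slice_paracomplex_chart)
  interpret slice2: paracomplex_chart U "slice_metric P (slice_metric P h t) (- t)" P
    by (rule slice.slice_paracomplex_chart)
  have "is_levi_civita_at h x (slice2.\<Gamma> x)"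
    by (rule is_levi_civita_at_cong[OF open_U x slice_slice slice2.is_levi_civita[OF x] slice2.G_differentiable[OF x]])
  then have "\<Gamma> x = slice2.\<Gamma> x" by (rule levi_civita_eqI[OF x])
  also have "\<dots> = slice.\<Gamma> x" by (rule slice.levi_civita_slice_parallel[OF x par])
  finally show ?thesis using par[of u v] by (simp add: nablaP_eq slice.nablaP_eq)
qed

end

section \<open>The metric of the product\<close>

definition product_metric ::
  "('e \<Rightarrow> 'e \<Rightarrow> 'e) \<Rightarrow> ('e \<Rightarrow> 'e \<Rightarrow> 'e \<Rightarrow> real) \<Rightarrow> real \<times> 'e \<Rightarrow> real \<times> 'e \<Rightarrow> real \<times> 'e \<Rightarrow> real" where
  "product_metric P h = (\<lambda>(t, x) (a, u) (b, v). a * b + slice_metric P h t x u v)"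

lemma product_metric_simp [simp]:
  "product_metric P h (t, x) (a, u) (b, v) = a * b + slice_metric P h t x u v"
  by (simp add: product_metric_def)

text \<open>A separate name for the same assumptions, so that the interpretation for all slices does not
  re-enter itself.\<close>

locale paracomplex_product = paracomplex_chart U h P
  for U :: "'e::euclidean_space set" and h P
begin

abbreviation ht where "ht t \<equiv> slice_metric P h t"
abbreviation \<Gamma>t where "\<Gamma>t t \<equiv> levi_civita (slice_metric P h t)"
abbreviation g where "g \<equiv> product_metric P h"

sublocale slice: paracomplex_chart U "slice_metric P h t" P for t
  by (rule slice_paracomplex_chart)

text \<open>The \<open>t\<close>-derivative is \<open>2 sinh 2t h(u, v) + 2 cosh 2t h(u, Pv) = 2 h\<^sub>t(Pu, v)\<close>.\<close>

lemma has_derivative_slice_metric: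
  assumes x: "x \<in> U"
  shows "((\<lambda>z. ht (fst z) (snd z) u v) has_derivative
     (\<lambda>w. 2 * fst w * ht t x (P x u) v + (ht t x (\<Gamma>t t x (snd w) u) v + ht t x u (\<Gamma>t t x (snd w) v)))) (at (t, x))"
proof -
  have fst: "((\<lambda>z. 2 * fst z) has_derivative (\<lambda>w. 2 * fst w)) (at (t, x))"
    by (auto intro!: derivative_eq_intros)
  have d: "(cosh has_real_derivative sinh y) (at y)" "(sinh has_real_derivative cosh y) (at y)" for y :: real
    by (auto intro!: derivative_eq_intros)
  have c: "((\<lambda>z. cosh (2 * fst z)) has_derivative (\<lambda>w. 2 * fst w * sinh (2 * t))) (at (t, x))"
    and s: "((\<lambda>z. sinh (2 * fst z)) has_derivative (\<lambda>w. 2 * fst w * cosh (2 * t))) (at (t, x))"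
    using DERIV_compose_FDERIV[where f = cosh and g = "\<lambda>z. 2 * fst z" and x = "(t, x)", OF _ fst] d(1)[of "2 * t"]
      DERIV_compose_FDERIV[where f = sinh and g = "\<lambda>z. 2 * fst z" and x = "(t, x)", OF _ fst] d(2)[of "2 * t"]
    by simp_all
  have h1: "((\<lambda>y. h y u v) has_derivative (\<lambda>w. frechet_derivative (\<lambda>y. h y u v) (at x) w)) (at x)"
    using G_differentiable[OF x] by (simp add: frechet_derivative_works)
  have h2: "((\<lambda>y. h y u (P y v)) has_derivative (\<lambda>w. frechet_derivative (\<lambda>y. h y u (P y v)) (at x) w)) (at x)"
    using differentiableI[OF has_derivative_metric[OF x has_derivative_const[of u] has_derivative_P_const[OF x, of v]]]
    unfolding frechet_derivative_works .
  have "frechet_derivative (\<lambda>y. ht t y u v) (at x) w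
      = cosh (2 * t) * frechet_derivative (\<lambda>y. h y u v) (at x) w
        + sinh (2 * t) * frechet_derivative (\<lambda>y. h y u (P y v)) (at x) w" for w
    using fun_cong[OF frechet_derivative_at[OF has_derivative_add[OF has_derivative_mult_right[OF h1, of "cosh (2 * t)"]
       has_derivative_mult_right[OF h2, of "sinh (2 * t)"]]], of w]
    unfolding slice_metric_def by simp
  note sl = this[unfolded slice.levi_civita_metric[OF x]]
  have h1': "((\<lambda>z. h (snd z) u v) has_derivative (\<lambda>w. frechet_derivative (\<lambda>y. h y u v) (at x) (snd w))) (at (t, x))"
    by (rule has_derivative_comp_snd[OF h1])
  have h2': "((\<lambda>z. h (snd z) u (P (snd z) v)) has_derivative
      (\<lambda>w. frechet_derivative (\<lambda>y. h y u (P y v)) (at x) (snd w))) (at (t, x))"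
    by (rule has_derivative_comp_snd[OF h2])
  show ?thesis
    unfolding slice_metric_def[of _ _ "fst _"]
    by (rule has_derivative_eq_rhs[OF has_derivative_add[OF has_derivative_mult[OF c h1'] has_derivative_mult[OF s h2']]])
       (simp add: fun_eq_iff sl, simp add: slice_metric_def P_P P_adjoint x algebra_simps)
qed

lemma has_derivative_product_metric:
  assumes x: "x \<in> U"
  shows "((\<lambda>z. g z (b, v) (c, w)) has_derivative
     (\<lambda>p. 2 * fst p * ht t x (P x v) w + (ht t x (\<Gamma>t t x (snd p) v) w + ht t x v (\<Gamma>t t x (snd p) w)))) (at (t, x))"
proof -
  have "(\<lambda>z. g z (b, v) (c, w)) = (\<lambda>z. b * c + ht (fst z) (snd z) v w)"
    by (simp add: fun_eq_iff)
  then show ?thesis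
    using has_derivative_add[OF has_derivative_const has_derivative_slice_metric[OF x]] by fastforce
qed

lemma product_riemannian_chart: "riemannian_chart (UNIV \<times> U) g"
proof
  show "open (UNIV \<times> U)" by (intro open_Times open_UNIV open_U)
  fix z u v :: "real \<times> 'e" assume "z \<in> UNIV \<times> U"
  then obtain t x where z: "z = (t, x)" "x \<in> U" by auto
  obtain a u' b v' where uv: "u = (a, u')" "v = (b, v')" by (metis surj_pair)
  show "bilinear (g z)"
    by (auto simp: z bilinear_def linear_iff slice.G_simps algebra_simps)
  show "g z u v = g z v u"
    by (simp add: z uv slice.sym[OF z(2), of _ u'])
  show "(\<lambda>y. g y u v) differentiable (at z)"
    using has_derivative_product_metric[OF z(2)] unfolding differentiable_def uv z(1) by blast
  show "0 < g z u u" if "u \<noteq> 0"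
  proof (cases "u' = 0")
    case True
    then have "a \<noteq> 0" using that uv by (simp add: zero_prod_def)
    then show ?thesis using True zero_less_power2[of a] by (simp add: z uv slice.G_simps power2_eq_square)
  next
    case False
    then show ?thesis by (simp add: z uv add_nonneg_pos slice.pos)
  qed
qed

sublocale product: riemannian_chart "UNIV \<times> U" g
  by (rule product_riemannian_chart)

text \<open>The slices have unit normal \<open>\<xi>\<close> and second fundamental form \<open>- h\<^sub>t(Pu, v)\<close>; uniqueness of the Levi-Civita
  connection reduces the claim to metricity.\<close>

lemma levi_civita_product:
  assumes x: "x \<in> U"
  shows "levi_civita g (t, x) (a, u) (b, v)
    = (- ht t x (P x u) v, a *\<^sub>R P x v + b *\<^sub>R P x u + \<Gamma>t t x u v)"
proof -
  define L where "L = (\<lambda>(a, u) (b, v). (- ht t x (P x u) v, a *\<^sub>R P x v + b *\<^sub>R P x u + \<Gamma>t t x u v))"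
  note simps = slice.G_simps slice.levi_civita_simps P_simps x
  have "is_levi_civita_at g (t, x) L"
    unfolding is_levi_civita_at_def
  proof (intro conjI allI)
    show "bilinear L"
      by (auto simp: bilinear_def linear_iff L_def simps algebra_simps)
    fix A B C :: "real \<times> 'e"
    obtain a u b v c w where ABC: "A = (a, u)" "B = (b, v)" "C = (c, w)" by (metis surj_pair)
    have s: "ht t x (P x u) v = ht t x (P x v) u" for u v
      by (simp add: slice.P_adjoint[OF x, of t u] slice.sym[OF x, of t u])
    show "L A B = L B A"
      by (simp add: L_def ABC s[of u] slice.levi_civita_commute[OF x, of t u])
    show "frechet_derivative (\<lambda>y. g y A B) (at (t, x)) C = g (t, x) (L C A) B + g (t, x) A (L C B)"
      using frechet_derivative_at[OF has_derivative_product_metric[OF x, of a u b v t], symmetric]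
      by (simp add: ABC L_def simps s slice.P_adjoint[OF x, of t w] slice.P_adjoint[OF x, of t u] algebra_simps)
  qed
  from product.levi_civita_eqI[OF _ this] show ?thesis by (simp add: x L_def)
qed

text \<open>Here \<open>\<xi> = (1, 0)\<close>.  Since \<open>\<nabla>\<^sub>V \<xi> = (0, Pv)\<close>, only \<open>P\<close> is differentiated and no derivative of \<open>\<Gamma>\<^sub>t\<close>
  enters; the first two terms are the Codazzi equation of the slice.\<close>

lemma curvature_product_vertical:
  assumes x: "x \<in> U"
  shows "curvature g (t, x) (a, u) (b, v) (1, 0)
    = (0, slice.nablaP t x u v - slice.nablaP t x v u + a *\<^sub>R v - b *\<^sub>R u)"
proof -
  note simps = slice.G_simps slice.levi_civita_simps P_simps x
  have D: "frechet_derivative (\<lambda>z. levi_civita g z (b, v) (1, 0)) (at (t, x)) (a, u) = (0, dP x u v)" for a b u v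
  proof -
    have "((\<lambda>z::real \<times> 'e. (0::real, P (snd z) v)) has_derivative (\<lambda>w. (0, dP x (snd w) v))) (at (t, x))"
      by (intro has_derivative_Pair has_derivative_const has_derivative_comp_snd has_derivative_P_const[OF x])
    then have "((\<lambda>z. levi_civita g z (b, v) (1, 0)) has_derivative (\<lambda>w. (0, dP x (snd w) v))) (at (t, x))"
      by (rule has_derivative_transform_within_open[OF _ product.open_U])
         (auto simp: levi_civita_product slice.G_simps slice.levi_civita_simps P_simps x)
    then show ?thesis by (simp flip: frechet_derivative_at)
  qed
  show ?thesis
    by (simp add: product.curvature_eq x D levi_civita_product simps slice.nablaP_eq
        slice.levi_civita_commute[OF x, of t v u] slice.sym[OF x, of t u "P x v"] slice.sym[OF x, of t u v] slice.sym[OF x, of t "P x u"] algebra_simps)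
qed

text \<open>For parallel \<open>P\<close> the connection of the slices is constant in \<open>t\<close>, so that apart from the curvature of \<open>h\<close>
  only algebraic terms in \<open>P\<close> remain.\<close>

lemma curvature_product_parallel:
  assumes x: "x \<in> U" and par: "\<And>y u v. y \<in> U \<Longrightarrow> nablaP y u v = 0"
    and \<Gamma>: "\<And>v w. (\<lambda>y. \<Gamma> y v w) differentiable (at x)"
  shows "curvature g (t, x) (a, u) (b, v) (c, w)
    = (b * ht t x u w - a * ht t x v w,
       curvature h x u v w + c *\<^sub>R (a *\<^sub>R v - b *\<^sub>R u) - ht t x (P x v) w *\<^sub>R P x u + ht t x (P x u) w *\<^sub>R P x v)"
proof -
  have q: "(t, x) \<in> UNIV \<times> U" using x by simp
  note simps = slice.G_simps levi_civita_simps P_simps x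
  have \<Gamma>t: "\<Gamma>t s y = \<Gamma> y" if "y \<in> U" for s y by (rule levi_civita_slice_parallel[OF that par[OF that]])
  have dP: "dP x u w = P x (\<Gamma> x u w) - \<Gamma> x u (P x w)" for u w
    using par[OF x, of u w] by (simp add: nablaP_eq algebra_simps)
  note L = levi_civita_product[OF x, unfolded \<Gamma>t[OF x]]
  have P': "((\<lambda>z. P (snd z) v) has_derivative (\<lambda>A. dP x (snd A) v)) (at (t, x))" for v
    by (rule has_derivative_comp_snd[OF has_derivative_P_const[OF x]])
  have \<Gamma>': "((\<lambda>z. \<Gamma> (snd z) v w) has_derivative (\<lambda>A. frechet_derivative (\<lambda>y. \<Gamma> y v w) (at x) (snd A))) (at (t, x))" for v w
    by (rule has_derivative_comp_snd[OF \<Gamma>[unfolded frechet_derivative_works]])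
  have D: "frechet_derivative (\<lambda>z. levi_civita g z (b, v) (c, w)) (at (t, x)) (a, u)
      = (- (2 * a * ht t x v w + ht t x (P x (\<Gamma> x u v)) w + ht t x (P x v) (\<Gamma> x u w)),
         b *\<^sub>R dP x u w + c *\<^sub>R dP x u v + frechet_derivative (\<lambda>y. \<Gamma> y v w) (at x) u)" for a b u v
  proof -
    have "((\<lambda>z. g z (0, P (snd z) v) (0, w)) has_derivative
        (\<lambda>A. g (t, x) ((0, dP x (snd A) v) + levi_civita g (t, x) A (0, P x v)) (0, w)
           + g (t, x) (0, P x v) (0 + levi_civita g (t, x) A (0, w)))) (at (t, x))"
      using product.has_derivative_metric[OF q has_derivative_Pair[OF has_derivative_const P'] has_derivative_const]
      by simp
    from has_derivative_Pair[OF has_derivative_minus[OF this]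
        has_derivative_add[OF has_derivative_add[OF has_derivative_scaleR_right[OF P']
          has_derivative_scaleR_right[OF P']] \<Gamma>'], of b w c v v w]
    have "((\<lambda>z. levi_civita g z (b, v) (c, w)) has_derivative
       (\<lambda>A. (- (g (t, x) ((0, dP x (snd A) v) + levi_civita g (t, x) A (0, P x v)) (0, w)
           + g (t, x) (0, P x v) (0 + levi_civita g (t, x) A (0, w))),
         b *\<^sub>R dP x (snd A) w + c *\<^sub>R dP x (snd A) v + frechet_derivative (\<lambda>y. \<Gamma> y v w) (at x) (snd A)))) (at (t, x))"
      by (rule has_derivative_transform_within_open[OF _ product.open_U q])
         (auto simp: levi_civita_product \<Gamma>t)
    from frechet_derivative_at[OF this, symmetric] show ?thesis
      by (simp add: L simps slice.P_isometry dP algebra_simps)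
  qed
  show ?thesis
    by (simp add: product.curvature_eq x D L curvature_eq simps slice.P_isometry dP
        levi_civita_commute[OF x, of v u] slice.sym[OF x, of t u v] algebra_simps)
qed

end

section \<open>Surfaces\<close>

locale paracomplex_surface_chart = paracomplex_product U h P
  for U :: "(real^2) set" and h P +
  assumes h_smooth: "smooth_on U (\<lambda>y. h y u v)"
    and P_smooth: "smooth_on U (\<lambda>y. P y v)"
    and trace_P: "x \<in> U \<Longrightarrow> trace_of (P x) = 0"
begin

lemma \<Gamma>_differentiable: "x \<in> U \<Longrightarrow> (\<lambda>y. \<Gamma> y u v) differentiable (at x)"
  by (rule levi_civita_differentiable_2[OF riemannian_chart_axioms _ h_smooth])

text \<open>A \<open>w\<close> that is not an eigenvector of \<open>P\<close>: if all vectors were eigenvectors, \<open>P\<close> would be a nonzero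
  multiple of the identity, and its trace would not vanish.\<close>

lemma cyclic_vector:
  assumes x: "x \<in> U"
  shows "\<exists>w. \<forall>z. \<exists>a b. z = a *\<^sub>R w + b *\<^sub>R P x w"
proof -
  let ?e = "axis 1 1 :: real^2" and ?f = "axis 2 1 :: real^2"
  define d where "d w = w $ 1 * P x w $ 2 - w $ 2 * P x w $ 1" for w
  \<comment> \<open>\<open>d w\<close> is the determinant of the pair \<open>w\<close>, \<open>P w\<close>; otherwise it vanishes at \<open>e\<close>, \<open>f\<close> and \<open>e + f\<close>\<close>
  have "\<exists>w. d w \<noteq> 0"
  proof (rule ccontr)
    assume "\<not> ?thesis"
    then have "d ?e = 0" "d ?f = 0" "d (?e + ?f) = 0" by blast+
    then have P0: "P x ?e $ 2 = 0" "P x ?f $ 1 = 0" "P x ?e $ 1 = P x ?f $ 2"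
      by (simp_all add: d_def axis_def P_simps x)
    then have "P x ?e $ 1 = 0" using trace_P[OF x] by (simp add: trace_of_2)
    then have "P x ?e = 0" using P0 by (simp add: vec_eq_iff forall_2)
    then have "?e = 0" using P_P[OF x, of ?e] by (simp add: P_simps x)
    then show False by (simp add: axis_eq_0_iff)
  qed
  then obtain w where w: "d w \<noteq> 0" by blast
  have "z = ((z $ 1 * P x w $ 2 - z $ 2 * P x w $ 1) / d w) *\<^sub>R w
      + ((w $ 1 * z $ 2 - w $ 2 * z $ 1) / d w) *\<^sub>R P x w" for z
  proof -
    have "d w *\<^sub>R z = (z $ 1 * P x w $ 2 - z $ 2 * P x w $ 1) *\<^sub>R w
        + (w $ 1 * z $ 2 - w $ 2 * z $ 1) *\<^sub>R P x w"
      by (simp add: vec_eq_iff forall_2 d_def algebra_simps)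
    from arg_cong[OF this, of "scaleR (inverse (d w))"] show ?thesis
      using w by (simp add: scaleR_add_right divide_inverse mult.commute)
  qed
  then show ?thesis by (intro exI[of _ w] allI exI)
qed

text \<open>For cyclic \<open>w\<close>, the vector \<open>R w\<close> is orthogonal to \<open>w\<close> because \<open>R\<close> is skew, and to \<open>Pw\<close> because
  \<open>P R = R P\<close> makes \<open>h(R w, Pw) = h(R Pw, w)\<close>, which is \<open>- h(R w, Pw)\<close> by skewness.  So \<open>R w = 0\<close>, and
  then \<open>R Pw = P R w = 0\<close>.\<close>

lemma parallel_imp_flat:
  assumes x: "x \<in> U" and par: "\<And>y u v. y \<in> U \<Longrightarrow> nablaP y u v = 0"
  shows "curvature h x u v z = 0"
proof -
  let ?R = "curvature h x u v"
  note \<Gamma> = \<Gamma>_differentiable[OF x]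
  have lin: "linear ?R" by (rule linear_curvature[OF x \<Gamma>])
  have skew: "h x (?R w) w = 0" for w by (rule curvature_skew[OF x h_smooth \<Gamma>])
  have comm: "?R (P x w) = P x (?R w)" for w
    by (rule curvature_commutes_P[OF x par P_smooth \<Gamma>])
  obtain w where w: "\<And>z. \<exists>a b. z = a *\<^sub>R w + b *\<^sub>R P x w"
    using cyclic_vector[OF x] by blast
  have "h x (?R w) (P x w) = 0"
    using skew[of "w + P x w"] skew[of w] skew[of "P x w"]
    by (simp add: linear_add[OF lin] comm G_simps P_isometry P_adjoint x)
  moreover obtain a b where ab: "?R w = a *\<^sub>R w + b *\<^sub>R P x w" using w by blast
  have "h x (?R w) (?R w) = a * h x (?R w) w + b * h x (?R w) (P x w)"
    by (subst (2) ab) (simp add: G_simps x)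
  ultimately have "h x (?R w) (?R w) = 0" by (simp add: skew)
  then have Rw: "?R w = 0" using pos[OF x, of "?R w"] by fastforce
  obtain a b where z: "z = a *\<^sub>R w + b *\<^sub>R P x w" using w by blast
  show ?thesis
    by (simp add: z linear_add[OF lin] linear_scale[OF lin] comm Rw P_simps x)
qed

lemma parallel_curvature_product:
  assumes x: "x \<in> U" and par: "\<And>y u v. y \<in> U \<Longrightarrow> nablaP y u v = 0"
  shows "curvature g (t, x) (a, u) (b, v) (c, w)
    = (b * ht t x u w - a * ht t x v w,
       c *\<^sub>R (a *\<^sub>R v - b *\<^sub>R u) - ht t x (P x v) w *\<^sub>R P x u + ht t x (P x u) w *\<^sub>R P x v)"
  by (simp add: curvature_product_parallel[OF x par \<Gamma>_differentiable[OF x]] parallel_imp_flat[OF x par])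

lemma linear_ht_P: "x \<in> U \<Longrightarrow> linear (\<lambda>u. ht t x (P x u) w)"
  by (rule linearI; simp add: slice.G_simps P_simps)

lemma ricci_parallel:
  assumes x: "x \<in> U" and par: "\<And>y u v. y \<in> U \<Longrightarrow> nablaP y u v = 0"
  shows "ricci g (t, x) (b, v) (c, w) = - 2 * b * c"
proof -
  have "ricci g (t, x) (b, v) (c, w) = - ht t x v w +
      trace_of (\<lambda>u. - (c * b) *\<^sub>R u - ht t x (P x v) w *\<^sub>R P x u + ht t x (P x u) w *\<^sub>R P x v)"
    by (simp add: product.ricci_eq_trace x trace_of_prod parallel_curvature_product[OF x par] slice.G_simps)
  then show ?thesis
    by (simp only: trace_of_add trace_of_diff trace_of_scaleR trace_of_id trace_P[OF x]
        trace_of_rank_one[OF linear_ht_P[OF x]])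
       (simp add: P_P x)
qed

lemma ricci_star_parallel:
  assumes x: "x \<in> U" and par: "\<And>y u v. y \<in> U \<Longrightarrow> nablaP y u v = 0"
    and \<phi>: "\<And>a u. \<phi> (t, x) (a, u) = (0, P x u)"
  shows "ricci_star g \<phi> (t, x) (b, v) (c, w) = - ht t x v (P x w)"
proof -
  have adj: "g (t, x) A (\<phi> (t, x) B) = g (t, x) (\<phi> (t, x) A) B" for A B
    by (cases A; cases B) (simp add: \<phi> slice.P_adjoint x)
  have "ricci_star g \<phi> (t, x) (b, v) (c, w) =
      trace_of (\<lambda>u. - (c * b) *\<^sub>R P x u - ht t x (P x v) w *\<^sub>R u + ht t x (P x u) w *\<^sub>R v)"
    by (simp add: product.ricci_star_eq_trace[where \<phi> = \<phi>, OF _ adj] x trace_of_prod \<phi> parallel_curvature_product[OF x par] P_simps)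
  then show ?thesis
    by (simp only: trace_of_add trace_of_diff trace_of_scaleR trace_of_id trace_P[OF x]
        trace_of_rank_one[OF linear_ht_P[OF x]])
       (simp add: slice.P_adjoint x)
qed

text \<open>The operator \<open>Q\<close> is the identity for \<open>\<rho>\<close> and \<open>P\<close> for \<open>\<rho>\<^sup>*\<close>.\<close>

lemma traceless_codazzi_imp_parallel:
  assumes x: "x \<in> U" and Q: "linear Q" "\<And>u. Q u = 0 \<Longrightarrow> u = 0"
    and tr: "\<And>v. trace_of (\<lambda>u. Q (slice.nablaP t x u v - slice.nablaP t x v u)) = 0"
  shows "nablaP x u v = 0"
proof -
  define C where "C u v = Q (slice.nablaP t x u v - slice.nablaP t x v u)" for u v
  note N = slice.bilinear_nablaP[OF x, of t]
  have "bilinear C"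
    unfolding bilinear_def
    by (auto simp: linear_iff C_def bilinear_ladd[OF N] bilinear_radd[OF N] bilinear_lmul[OF N]
        bilinear_rmul[OF N] linear_add[OF Q(1)] linear_diff[OF Q(1)] linear_scale[OF Q(1)] algebra_simps)
  moreover have "C u v = - C v u" for u v by (simp add: C_def linear_diff[OF Q(1)])
  ultimately have "C u v = 0" for u v
    by (rule alternating_traceless_eq_0) (simp add: C_def tr)
  then have "slice.nablaP t x u v = slice.nablaP t x v u" for u v using Q(2) unfolding C_def by force
  then have "slice.nablaP t x u v = 0" for u v by (rule slice.codazzi_imp_parallel[OF x])
  then show ?thesis by (rule parallel_if_slice_parallel[OF x])
qed

lemma ricci_imp_parallel:
  assumes x: "x \<in> U" and ric: "\<And>v. ricci g (t, x) (0, v) (1, 0) = 0"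
  shows "nablaP x u v = 0"
proof (rule traceless_codazzi_imp_parallel[OF x, of "\<lambda>u. u" t])
  show "trace_of (\<lambda>u. slice.nablaP t x u v - slice.nablaP t x v u) = 0" for v
    using ric[of v] by (simp add: product.ricci_eq_trace x trace_of_prod curvature_product_vertical)
qed (simp_all add: linear_iff)

lemma ricci_star_imp_parallel:
  assumes x: "x \<in> U" and \<phi>: "\<And>a u. \<phi> (t, x) (a, u) = (0, P x u)"
    and ric: "\<And>v. ricci_star g \<phi> (t, x) (0, v) (1, 0) = 0"
  shows "nablaP x u v = 0"
proof (rule traceless_codazzi_imp_parallel[OF x P_linear[OF x], of t])
  have adj: "g (t, x) A (\<phi> (t, x) B) = g (t, x) (\<phi> (t, x) A) B" for A B
    by (cases A; cases B) (simp add: \<phi> slice.P_adjoint x)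
  show "trace_of (\<lambda>u. P x (slice.nablaP t x u v - slice.nablaP t x v u)) = 0" for v
    using ric[of v]
    by (simp add: product.ricci_star_eq_trace[where \<phi> = \<phi>, OF _ adj] x trace_of_prod \<phi> curvature_product_vertical)
  show "u = 0" if "P x u = 0" for u using P_P[OF x, of u] that by (simp add: P_simps x)
qed

end

section \<open>The equivalences\<close>

lemma S_metric_eq: "S_metric P h i = product_metric (P i) (h i)"
  by (simp add: S_metric_def product_metric_def slice_metric_def paracomplex_assoc_def fun_eq_iff add.assoc)

lemma paracomplex_surface_chart:
  fixes N :: "('a, 'i, real ^ 2) manifold"
  assumes A: "almost_paracomplex_riemannian N P h" and i: "i \<in> charts N"
  shows "paracomplex_surface_chart (cimg N i) (h i) (P i)"
proof (intro paracomplex_surface_chart.intro paracomplex_product.intro paracomplex_chart.intro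
    riemannian_chart.intro paracomplex_chart_axioms.intro paracomplex_surface_chart_axioms.intro)
  have N: "smooth_manifold N" and P: "endomorphism_field N P" and h: "riemannian_metric N h"
    using A by (auto simp: almost_paracomplex_riemannian_def)
  show "open (cimg N i)" by (rule chart_open[OF N i])
  show hs: "smooth_on (cimg N i) (\<lambda>y. h i y u v)" and Ps: "smooth_on (cimg N i) (\<lambda>y. P i y v)" for u v
    using h P i by (auto simp: riemannian_metric_def endomorphism_field_def)
  fix x u v assume x: "x \<in> cimg N i"
  show "bilinear (h i x)" "h i x u v = h i x v u"
    using h i x by (auto simp: riemannian_metric_def)
  show "u \<noteq> 0 \<Longrightarrow> 0 < h i x u u"
    using h i x by (auto simp: riemannian_metric_def)
  show "(\<lambda>y. h i y u v) differentiable (at x)" "(\<lambda>y. P i y v) differentiable (at x)"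
    using smooth_on_has_derivative[OF hs x] smooth_on_has_derivative[OF Ps x] by (auto simp: differentiable_def)
  show "linear (P i x)"
    using P i x by (auto simp: endomorphism_field_def)
  show "P i x (P i x v) = v" "h i x (P i x u) (P i x v) = h i x u v" "trace_of (P i x) = 0"
    using A i x by (auto simp: almost_paracomplex_riemannian_def)
qed

theorem theorem3p4:
  fixes N :: "('a, 'i, real ^ 2) manifold"
    and P :: "'i \<Rightarrow> real ^ 2 \<Rightarrow> real ^ 2 \<Rightarrow> real ^ 2"
    and h :: "'i \<Rightarrow> real ^ 2 \<Rightarrow> real ^ 2 \<Rightarrow> real ^ 2 \<Rightarrow> real"
    and k :: "'a \<Rightarrow> real"
    and S :: "(real \<times> 'a, 'i, real \<times> (real ^ 2)) manifold"
    and \<phi> :: "'i \<Rightarrow> real \<times> (real ^ 2) \<Rightarrow> real \<times> (real ^ 2) \<Rightarrow> real \<times> (real ^ 2)"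
    and \<eta> :: "'i \<Rightarrow> real \<times> (real ^ 2) \<Rightarrow> real \<times> (real ^ 2) \<Rightarrow> real"
    and g :: "'i \<Rightarrow> real \<times> (real ^ 2) \<Rightarrow> real \<times> (real ^ 2) \<Rightarrow> real \<times> (real ^ 2) \<Rightarrow> real"
  assumes "almost_paracomplex_riemannian N P h"
    and "pointwise_sectional_curvature N h k"
    and "S = S_manifold N" and "\<phi> = S_phi P" and "\<eta> = S_eta" and "g = S_metric P h"
  shows "(W0_manifold N P h \<longleftrightarrow>
           (\<forall>i\<in>charts S. \<forall>(t, p)\<in>cdom S i. \<forall>y z.
              let q = cmap S i (t, p) in
              ricci (g i) q y z =
                k p * cosh (2 * t) * g i q y z
                - (2 + k p * cosh (2 * t)) * (\<eta> i q y * \<eta> i q z)))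
       \<and> (W0_manifold N P h \<longleftrightarrow>
           (\<forall>i\<in>charts S. \<forall>(t, p)\<in>cdom S i. \<forall>y z.
              let q = cmap S i (t, p) in
              ricci_star (g i) (\<phi> i) q y z =
                - (1 + k p * cosh (2 * t)) * (apapR_assoc \<phi> \<eta> g i q y z - \<eta> i q y * \<eta> i q z)))"
    (is "(?W \<longleftrightarrow> ?ric) \<and> (?W \<longleftrightarrow> ?ric_star)")
proof -
  let ?nabla = "\<lambda>i. covariant_derivative_endo (levi_civita (h i)) (P i)"
  have W: "?W \<longleftrightarrow> (\<forall>i\<in>charts N. \<forall>p\<in>cdom N i. \<forall>u v. ?nabla i (cmap N i p) u v = 0)"
    using assms(1) by (auto simp: W0_manifold_def cimg_def)
  have Sq: "charts S = charts N" "cdom S i = {0<..} \<times> cdom N i" "cmap S i (t, p) = (t, cmap N i p)" for i t p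
    by (simp_all add: assms S_manifold_def)
  have \<phi>: "\<phi> i (t, x) (a, u) = (0, P i x u)" and \<eta>: "\<eta> i (t, x) (a, u) = a" for i t x a u
    by (simp_all add: assms S_phi_def S_eta_def)
  have g: "g i = product_metric (P i) (h i)" for i by (simp add: assms S_metric_eq)
  have flat: "k p = 0" if W0: ?W and i: "i \<in> charts N" and p: "p \<in> cdom N i" for i p
  proof -
    interpret chart: paracomplex_surface_chart "cimg N i" "h i" "P i"
      by (rule paracomplex_surface_chart[OF assms(1) i])
    have x: "cmap N i p \<in> cimg N i" using p by (simp add: cimg_def)
    have par: "?nabla i y u v = 0" if "y \<in> cimg N i" for y u v
      using W0 i that by (simp add: W0_manifold_def)
    let ?e = "axis 1 1 :: real^2" and ?f = "axis 2 1 :: real^2"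
    have "independent (Basis :: (real^2) set)" by (rule independent_Basis)
    then have "independent {?e, ?f}"
      by (rule independent_mono) (auto simp: Basis_vec_def)
    moreover have "?e \<noteq> ?f" by (simp add: axis_eq_axis)
    ultimately have "k p = sectional_curvature (h i) (cmap N i p) ?e ?f"
      using assms(2)[unfolded pointwise_sectional_curvature_def, THEN bspec, OF i, THEN bspec, OF p,
          THEN spec, THEN spec, of ?e ?f] by simp
    also have "\<dots> = 0"
      by (simp add: sectional_curvature_def curvature4_def chart.parallel_imp_flat[OF x par] chart.G_simps x)
    finally show ?thesis .
  qed
  have forward: "ricci (g i) (t, cmap N i p) y z = k p * cosh (2 * t) * g i (t, cmap N i p) y z
      - (2 + k p * cosh (2 * t)) * (\<eta> i (t, cmap N i p) y * \<eta> i (t, cmap N i p) z) \<and>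
    ricci_star (g i) (\<phi> i) (t, cmap N i p) y z = - (1 + k p * cosh (2 * t)) *
      (apapR_assoc \<phi> \<eta> g i (t, cmap N i p) y z - \<eta> i (t, cmap N i p) y * \<eta> i (t, cmap N i p) z)"
    if W0: ?W and i: "i \<in> charts N" and p: "p \<in> cdom N i" for i p t y z
  proof -
    interpret chart: paracomplex_surface_chart "cimg N i" "h i" "P i"
      by (rule paracomplex_surface_chart[OF assms(1) i])
    have x: "cmap N i p \<in> cimg N i" using p by (simp add: cimg_def)
    have par: "?nabla i y u v = 0" if "y \<in> cimg N i" for y u v
      using W0 i that by (simp add: W0_manifold_def)
    obtain b v where y: "y = (b, v)" by (cases y)
    obtain c w where z: "z = (c, w)" by (cases z)
    show ?thesis
      by (simp add: y z g flat[OF W0 i p] \<eta> chart.ricci_parallel[OF x par]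
          chart.ricci_star_parallel[where \<phi> = "\<phi> i", OF x par \<phi>] apapR_assoc_def \<phi>)
  qed
  \<comment> \<open>the slice \<open>t = 1\<close> is chosen arbitrarily\<close>
  have backward: "?nabla i (cmap N i p) u v = 0"
    if i: "i \<in> charts N" and p: "p \<in> cdom N i"
      and ric: "(\<forall>v. ricci (g i) (1, cmap N i p) (0, v) (1, 0) = 0) \<or>
        (\<forall>v. ricci_star (g i) (\<phi> i) (1, cmap N i p) (0, v) (1, 0) = 0)" for i p u v
  proof -
    interpret chart: paracomplex_surface_chart "cimg N i" "h i" "P i"
      by (rule paracomplex_surface_chart[OF assms(1) i])
    have x: "cmap N i p \<in> cimg N i" using p by (simp add: cimg_def)
    show ?thesis
      using ric
    proof
      assume "\<forall>v. ricci (g i) (1, cmap N i p) (0, v) (1, 0) = 0"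
      then show ?thesis by (intro chart.ricci_imp_parallel[OF x, of 1]) (simp add: g)
    next
      assume "\<forall>v. ricci_star (g i) (\<phi> i) (1, cmap N i p) (0, v) (1, 0) = 0"
      then show ?thesis
        by (intro chart.ricci_star_imp_parallel[where \<phi> = "\<phi> i", OF x \<phi>, of 1]) (simp add: g)
    qed
  qed
  \<comment> \<open>this makes the right-hand sides of both formulas vanish on a pair of a horizontal vector and \<open>\<xi>\<close>\<close>
  have mixed: "g i (t, cmap N i p) (0, v) (c, 0) = 0" if "i \<in> charts N" "p \<in> cdom N i" for i p t v c
  proof -
    interpret chart: paracomplex_surface_chart "cimg N i" "h i" "P i"
      by (rule paracomplex_surface_chart[OF assms(1) that(1)])
    show ?thesis using that by (simp add: g cimg_def chart.slice.G_simps)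
  qed
  have "P i (cmap N i p) 0 = 0" if "i \<in> charts N" "p \<in> cdom N i" for i p
  proof -
    interpret chart: paracomplex_surface_chart "cimg N i" "h i" "P i"
      by (rule paracomplex_surface_chart[OF assms(1) that(1)])
    show ?thesis using that by (simp add: cimg_def chart.P_simps)
  qed
  note P0 = this
  have ric_imp: ?W if ric: ?ric
    unfolding W
  proof (intro ballI allI backward disjI1)
    fix i p v assume i: "i \<in> charts N" and p: "p \<in> cdom N i"
    then have iS: "i \<in> charts S" and pS: "(1, p) \<in> cdom S i" by (simp_all add: Sq)
    show "ricci (g i) (1, cmap N i p) (0, v) (1, 0) = 0"
      using ric[THEN bspec, OF iS, THEN bspec, OF pS, unfolded prod.case, THEN spec, THEN spec,
          of "(0, v)" "(1, 0)"]
      by (simp add: Sq Let_def \<eta> mixed[OF i p])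
  qed
  have ric_star_imp: ?W if ric: ?ric_star
    unfolding W
  proof (intro ballI allI backward disjI2)
    fix i p v assume i: "i \<in> charts N" and p: "p \<in> cdom N i"
    then have iS: "i \<in> charts S" and pS: "(1, p) \<in> cdom S i" by (simp_all add: Sq)
    show "ricci_star (g i) (\<phi> i) (1, cmap N i p) (0, v) (1, 0) = 0"
      using ric[THEN bspec, OF iS, THEN bspec, OF pS, unfolded prod.case, THEN spec, THEN spec,
          of "(0, v)" "(1, 0)"] mixed[OF i p]
      by (simp add: Sq Let_def \<eta> apapR_assoc_def \<phi> P0[OF i p])
  qed
  have imp: "?ric \<and> ?ric_star" if ?W
  proof (intro conjI ballI)
    fix i tp assume "i \<in> charts S" "tp \<in> cdom S i"
    then obtain t p where tp: "tp = (t, p)" and i: "i \<in> charts N" and p: "p \<in> cdom N i"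
      by (auto simp: Sq)
    show "case tp of (t, p) \<Rightarrow> \<forall>y z.
              let q = cmap S i (t, p) in
              ricci (g i) q y z =
                k p * cosh (2 * t) * g i q y z
                - (2 + k p * cosh (2 * t)) * (\<eta> i q y * \<eta> i q z)"
      unfolding tp prod.case Sq Let_def by (intro allI conjunct1[OF forward[OF that i p]])
    show "case tp of (t, p) \<Rightarrow> \<forall>y z.
              let q = cmap S i (t, p) in
              ricci_star (g i) (\<phi> i) q y z =
                - (1 + k p * cosh (2 * t)) * (apapR_assoc \<phi> \<eta> g i q y z - \<eta> i q y * \<eta> i q z)"
      unfolding tp prod.case Sq Let_def by (intro allI conjunct2[OF forward[OF that i p]])
  qed
  show ?thesis
    by (rule conjI; rule iffI; (rule imp[THEN conjunct1] imp[THEN conjunct2] ric_imp ric_star_imp; assumption))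
qed

end
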